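(* Let $n\ge1$, a setpoint $y^*\in\mathbb{R}$, constants $\underline{b}>0$, $\overline{b}>0$, $L>0$, and an increasing function $\tau:[0,\infty)\to[0,\infty)$ be given (known). Then there exists an open unbounded set (an $(n+1)$-dimensional unbounded parameter manifold) $\Omega\subset\mathbb{R}^{n+1}$, depending only on these data, such that the following holds for every system $\dot x=f(x)+g(x)u$, $y=h(x)$ on $\mathbb{R}^n$ satisfying Assumptions (A), (B1) and (C): whenever $(k_0,\dots,k_n)\in\Omega$, for every initial state $x(0)\in\mathbb{R}^n$, the solution of the closed-loop system formed with the extended PID controller $$u(t)=k_1e(t)+k_0\int_0^te(s)\,ds+k_2\dot e(t)+\cdots+k_ne^{(n-1)}(t),\qquad e(t)=y^*-y(t),$$ exists on $[0,\infty)$ and the regulation error $e(t)$ converges to $0$ exponentially. Moreover, if Assumption (C) is replaced by Assumption (C'), then there exists an open unbounded set (an $(n+1)$-dimensional unbounded parameter manifold) $\Omega\subset\mathbb{R}^{n+1}$, depending only on $n,y^*,\underline{b},\overline{b},L,\tau$, such that for every system $\dot x=f(x)+g(x)u$, $y=h(x)$ on $\mathbb{R}^n$ satisfying Assumptions (A), (B1) and (C'), whenever $(k_0,\dots,k_n)\in\Omega$, for every initial state $x(0)\in\mathbb{R}^n$, the solution of the closed-loop system formed with the extended PID controller $u(t)=k_1e(t)+k_0\int_0^te(s)\,ds+k_2\dot e(t)+\cdots+k_ne^{(n-1)}(t)$, $e(t)=y^*-y(t)$, exists on $[0,\infty)$ and the regulation error $e(t)$ converges to $0$ exponentially, and in addition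 there exists $x^*\in\mathbb{R}^n$, depending only on $y^*$ and $\Phi$, such that the state $x(t)$ is bounded and $\lim_{t\to\infty}x(t)=x^*$.
   Context: $\|\cdot\|$ is the Euclidean norm on vectors and the induced operator norm on matrices. The system is the single-input single-output affine nonlinear system $\dot x=f(x)+g(x)u$, $y=h(x)$, where $f,g:\mathbb{R}^n\to\mathbb{R}^n$ are smooth vector fields and $h:\mathbb{R}^n\to\mathbb{R}$ is a smooth function, all unknown. Lie derivatives: $L_f h=\sum_i \frac{\partial h}{\partial x_i}f_i$, $L_f^0h=h$, $L_f^kh=L_f(L_f^{k-1}h)$, $L_gL_f^kh=\sum_i\frac{\partial L_f^kh}{\partial x_i}g_i$. Define $$\Phi(x)=(h(x),L_fh(x),\dots,L_f^{n-1}h(x))^T,\quad F(x)=L_f^nh(x),\quad G(x)=L_gL_f^{n-1}h(x),\quad H(x)=(F(x),G(x)),$$ and $z^*=(y^*,0,\dots,0)^T\in\mathbb{R}^n$, $\Phi^{-1}(z)=\{x\in\mathbb{R}^n:\Phi(x)=z\}$. $J_\Phi(x)$ denotes the Jacobian matrix of $\Phi$ and $J_\Phi^{-1}(x)$ its matrix inverse. Assumption (A): the system has uniform relative degree $n$, i.e. $L_gL_f^ih(x)=0$ for $0\le i\le n-2$ and $G(x)\ne0$ for all $x\in\mathbb{R}^n$; moreover $G(x)\ge\underline{b}>0$ for all $x\in\mathbb{R}^n$. Assumption (B1): (i) $G(x)\le\overline{b}$ and $\|H(x)\|\le\tau(\|\Phi(x)\|)$ for all $x\in\mathbb{R}^n$;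 (ii) there exists $x^*\in\Phi^{-1}(z^* )$ such that $\|H(x)-H(x^* )\|\le L\|\Phi(x)-\Phi(x^* )\|$ for all $x\in\mathbb{R}^n$. Assumption (C): there are constants $N_1>0$, $N_2>0$ (possibly unknown) such that $\|J_\Phi^{-1}(x)\|\le N_1\|x\|\log\|x\|+N_2$ for all $x\in\mathbb{R}^n$ (with $0\log 0=0$). Assumption (C'): $\Phi$ is a global diffeomorphism of $\mathbb{R}^n$, i.e. a bijection with $\Phi$ and its inverse continuously differentiable. Closed loop: under (A), along solutions $y^{(j)}=L_f^jh(x)$ for $0\le j\le n-1$, so the controller is $u=k_0x_0+k_1(y^*-h(x))-\sum_{j=2}^nk_jL_f^{j-1}h(x)$ with $\dot x_0=y^*-h(x)$, $x_0(0)=0$. "$e(t)$ converges to $0$ exponentially" means there are $C,\alpha>0$ with $|e(t)|\le Ce^{-\alpha t}$ for all $t\ge0$. *)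

theory Defs
  imports "HOL-Analysis.Analysis"
begin

text \<open>
  The state space is \<open>real ^ 'n\<close> with \<open>n = CARD('n)\<close>. The index type is linearly ordered because
  the components of the map \<open>\<Phi> = (h, L\<^sub>f h, \<dots>)\<close> and the gains \<open>k\<^sub>1, \<dots>, k\<^sub>n\<close> come in a fixed
  order; \<open>pos\<close> is the position of an index, counted from 0.
\<close>

definition pos :: "'n::{finite,linorder} \<Rightarrow> nat" where
  "pos i = card {..<i}"

lemma bij_betw_pos: "bij_betw (pos :: 'n::{finite,linorder} \<Rightarrow> nat) UNIV {..<CARD('n)}"
proof -
  have less: "pos i < pos j" if "i < j" for i j :: 'n
    unfolding pos_def using that by (intro psubset_card_mono) auto
  have inj: "inj (pos :: 'n \<Rightarrow> nat)"
    by (rule injI) (metis less less_irrefl neqE)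
  have "pos i < CARD('n)" for i :: 'n
    unfolding pos_def by (intro psubset_card_mono) auto
  then have "range (pos :: 'n \<Rightarrow> nat) \<subseteq> {..<CARD('n)}"
    by auto
  moreover have "card (range (pos :: 'n \<Rightarrow> nat)) = card {..<CARD('n)}"
    by (simp add: card_image inj)
  ultimately have "range (pos :: 'n \<Rightarrow> nat) = {..<CARD('n)}"
    by (intro card_subset_eq) auto
  with inj show ?thesis
    by (simp add: bij_betw_def)
qed


type_synonym 'n state = "(real, 'n) vec"
type_synonym 'n vfield = "'n state \<Rightarrow> 'n state"
type_synonym 'n outmap = "'n state \<Rightarrow> real"
type_synonym 'n gains = "real \<times> 'n state"


text \<open>\<open>Ck k F\<close>: the map \<open>F\<close> is \<open>k\<close> times continuously differentiable on the whole space.\<close>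

fun Ck :: "nat \<Rightarrow> ('a::euclidean_space \<Rightarrow> 'b::real_normed_vector) \<Rightarrow> bool" where
  "Ck 0 F \<longleftrightarrow> continuous_on UNIV F"
| "Ck (Suc k) F \<longleftrightarrow>
     (\<forall>x. F differentiable (at x)) \<and> (\<forall>v. Ck k (\<lambda>x. frechet_derivative F (at x) v))"

definition smooth :: "('a::euclidean_space \<Rightarrow> 'b::real_normed_vector) \<Rightarrow> bool" where
  "smooth F \<longleftrightarrow> (\<forall>k. Ck k F)"

definition C1_diffeomorphism :: "('a::euclidean_space \<Rightarrow> 'b::euclidean_space) \<Rightarrow> bool" where
  "C1_diffeomorphism F \<longleftrightarrow> bij F \<and> Ck 1 F \<and> Ck 1 (inv F)"


definition lie :: "'n::finite vfield \<Rightarrow> 'n outmap \<Rightarrow> 'n state \<Rightarrow> real" where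
  "lie f h x = (\<Sum>i\<in>UNIV. frechet_derivative h (at x) (axis i 1) * f x $ i)"

definition Phi ::
  "'n::{finite,linorder} vfield \<Rightarrow> 'n outmap \<Rightarrow> 'n state \<Rightarrow> 'n state" where
  "Phi f h x = (\<chi> i. (lie f ^^ pos i) h x)"

definition F_fun :: "'n::finite vfield \<Rightarrow> 'n outmap \<Rightarrow> 'n state \<Rightarrow> real" where
  "F_fun f h = (lie f ^^ CARD('n)) h"

definition G_fun ::
  "'n::finite vfield \<Rightarrow> 'n vfield \<Rightarrow> 'n outmap \<Rightarrow> 'n state \<Rightarrow> real" where
  "G_fun f g h = lie g ((lie f ^^ (CARD('n) - 1)) h)"

text \<open>The norm on pairs of reals is the Euclidean one.\<close>

definition H_fun ::
  "'n::finite vfield \<Rightarrow> 'n vfield \<Rightarrow> 'n outmap \<Rightarrow> 'n state \<Rightarrow> real \<times> real" where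
  "H_fun f g h x = (F_fun f h x, G_fun f g h x)"

definition zstar :: "real \<Rightarrow> 'n::{finite,linorder} state" where
  "zstar ystar = (\<chi> i. if pos i = 0 then ystar else 0)"


definition uniform_relative_degree ::
  "'n::finite vfield \<Rightarrow> 'n vfield \<Rightarrow> 'n outmap \<Rightarrow> bool" where
  "uniform_relative_degree f g h \<longleftrightarrow>
     (\<forall>x. (\<forall>i. i + 2 \<le> CARD('n) \<longrightarrow> lie g ((lie f ^^ i) h) x = 0) \<and> G_fun f g h x \<noteq> 0)"

definition assumption_A ::
  "real \<Rightarrow> 'n::finite vfield \<Rightarrow> 'n vfield \<Rightarrow> 'n outmap \<Rightarrow> bool" where
  "assumption_A b_lo f g h \<longleftrightarrow>
     uniform_relative_degree f g h \<and> (\<forall>x. b_lo \<le> G_fun f g h x)"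

definition assumption_B1 ::
  "real \<Rightarrow> real \<Rightarrow> real \<Rightarrow> (real \<Rightarrow> real) \<Rightarrow> 'n::{finite,linorder} vfield \<Rightarrow> 'n vfield \<Rightarrow>
     'n outmap \<Rightarrow> bool" where
  "assumption_B1 ystar b_up L \<tau> f g h \<longleftrightarrow>
     (\<forall>x. G_fun f g h x \<le> b_up \<and> norm (H_fun f g h x) \<le> \<tau> (norm (Phi f h x))) \<and>
     (\<exists>xs \<in> Phi f h -` {zstar ystar}.
        \<forall>x. norm (H_fun f g h x - H_fun f g h xs) \<le> L * norm (Phi f h x - Phi f h xs))"

text \<open>The convention \<open>0 log 0 = 0\<close> holds automatically, whatever the value of \<open>ln 0\<close>.\<close>

definition assumption_C ::
  "'n::{finite,linorder} vfield \<Rightarrow> 'n outmap \<Rightarrow> bool" where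
  "assumption_C f h \<longleftrightarrow>
     (\<exists>N1>0. \<exists>N2>0. \<forall>x.
        onorm ((*v) (matrix_inv (jacobian (Phi f h) (at x)))) \<le> N1 * norm x * ln (norm x) + N2)"

definition assumption_C' ::
  "'n::{finite,linorder} vfield \<Rightarrow> 'n outmap \<Rightarrow> bool" where
  "assumption_C' f h \<longleftrightarrow> C1_diffeomorphism (Phi f h)"


text \<open>Time derivative on \<open>[0,\<infinity>)\<close>, one-sided at 0.\<close>

definition tderiv :: "(real \<Rightarrow> real) \<Rightarrow> real \<Rightarrow> real" where
  "tderiv e t = vector_derivative e (at t within {0..})"

definition reg_error :: "real \<Rightarrow> 'n::finite outmap \<Rightarrow> (real \<Rightarrow> 'n state) \<Rightarrow> real \<Rightarrow> real" where
  "reg_error ystar h x t = ystar - h (x t)"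

text \<open>
  The gains \<open>(k\<^sub>0, k\<^sub>1, \<dots>, k\<^sub>n)\<close> form a point of \<open>real \<times> real ^ 'n\<close>; the component of \<open>snd k\<close>
  at position \<open>j - 1\<close> is \<open>k\<^sub>j\<close> and multiplies the error derivative of order \<open>j - 1\<close>.
\<close>

definition extended_pid :: "'n::{finite,linorder} gains \<Rightarrow> (real \<Rightarrow> real) \<Rightarrow> real \<Rightarrow> real" where
  "extended_pid k e t =
     fst k * integral {0..t} e + (\<Sum>i\<in>UNIV. snd k $ i * (tderiv ^^ pos i) e t)"

text \<open>
  A solution on \<open>[0,\<infinity>)\<close> of the closed loop. The second conjunct says that the error derivatives
  up to order \<open>n - 1\<close> used by the controller exist; under uniform relative degree \<open>n\<close> this is
  automatic, the derivative of order \<open>j \<ge> 1\<close> at time \<open>t\<close> being \<open>- (lie f ^^ j) h (x t)\<close>.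
\<close>

definition closed_loop_solution ::
  "real \<Rightarrow> 'n::{finite,linorder} vfield \<Rightarrow> 'n vfield \<Rightarrow> 'n outmap \<Rightarrow>
     'n gains \<Rightarrow> 'n state \<Rightarrow> (real \<Rightarrow> 'n state) \<Rightarrow> bool" where
  "closed_loop_solution ystar f g h k \<xi> x \<longleftrightarrow>
     x 0 = \<xi> \<and>
     (\<forall>j. j + 1 < CARD('n) \<longrightarrow>
        (\<forall>t\<ge>0. (tderiv ^^ j) (reg_error ystar h x) differentiable (at t within {0..}))) \<and>
     (\<forall>t\<ge>0. (x has_vector_derivative
        (f (x t) + extended_pid k (reg_error ystar h x) t *\<^sub>R g (x t))) (at t within {0..}))"

definition exp_convergent :: "(real \<Rightarrow> real) \<Rightarrow> bool" where
  "exp_convergent e \<longleftrightarrow> (\<exists>C>0. \<exists>\<alpha>>0. \<forall>t\<ge>0. \<bar>e t\<bar> \<le> C * exp (- \<alpha> * t))"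

end

theory Submission
  imports Defs
begin

text \<open>
  In the coordinates \<open>z = \<Phi> x\<close> the plant is a chain of integrators, \<open>z\<^sub>1' = z\<^sub>2, \<dots>, z\<^sub>n' = F + G u\<close>,
  and the integral term of the controller puts one more integrator in front. The constant input
  \<open>- F (x\<^sup>*) / G (x\<^sup>*)\<close> that holds the plant at the setpoint is supplied by the integral state at its
  equilibrium value. In deviations from the equilibrium the closed loop is therefore a chain of
  \<open>n + 1\<close> variables \<open>w\<^sub>0, \<dots>, w\<^sub>n\<close> whose last equation has a feedback term multiplied by \<open>G \<ge> b_lo\<close>
  and a drift that the Lipschitz condition at \<open>x\<^sup>*\<close> bounds by a known multiple of \<open>\<bar>w\<bar>\<close>.

  The gains are taken near a multiple \<open>\<kappa>\<close> of the coefficients of \<open>(d/dt + 2)\<^sup>n\<close>. With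
  \<open>s\<^sub>i = (d/dt + 2)\<^sup>i w\<^sub>0\<close> the equations become \<open>s\<^sub>i' = s\<^sub>i\<^sub>+\<^sub>1 - 2 s\<^sub>i\<close> below the top, and the feedback
  is \<open>- \<kappa> G s\<^sub>n\<close> up to a bounded perturbation of the gains. For \<open>\<kappa>\<close> above a threshold determined
  by the known data, the derivative of \<open>V = \<Sum> s\<^sub>i\<^sup>2\<close> is at most \<open>- V\<close> (\<open>high_gain_decay\<close>), on
  whatever interval the solution exists. The admissible gains are the union of the unit balls
  around the points of a ray, an open unbounded set.

  It remains to exclude finite escape time of \<open>x\<close>, since the decay controls only the integral state
  and \<open>\<Phi> x\<close>. If \<open>\<Phi>\<close> is a diffeomorphism, \<open>x = \<Phi>\<^sup>-\<^sup>1 z\<close> stays in a compact set and converges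
  because \<open>z\<close> does. Under the growth condition on the inverse Jacobian, the velocity
  \<open>x' = J\<^sup>-\<^sup>1 z'\<close> is \<open>O(\<parallel>x\<parallel> log \<parallel>x\<parallel>)\<close>, so \<open>log (e + \<parallel>x\<parallel>\<^sup>2)\<close> grows at most exponentially
  (\<open>norm_bound_if_log_growth\<close>). This uses that \<open>J\<close> is invertible, which follows from the relative
  degree: the iterated Lie brackets of \<open>f\<close> with \<open>g\<close> pair with the rows of \<open>J\<close> in a triangular array
  (\<open>invertible_jacobian_Phi\<close>).

  Existence of solutions is obtained by Picard iteration for globally Lipschitz fields, and then by
  truncation outside a large ball for fields whose solutions obey an a priori bound
  (\<open>global_solution_if_bounded\<close>).
\<close>

section \<open>Calculus of smooth maps\<close>

abbreviation dir_deriv ::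
  "('a::euclidean_space \<Rightarrow> 'b::real_normed_vector) \<Rightarrow> 'a \<Rightarrow> 'a \<Rightarrow> 'b" where
  "dir_deriv F v x \<equiv> frechet_derivative F (at x) v"

lemma dir_deriv_eqI: "(F has_derivative F') (at x) \<Longrightarrow> dir_deriv F v x = F' v"
  by (metis frechet_derivative_at)

lemma Ck_imp_continuous: "Ck k F \<Longrightarrow> continuous_on UNIV F"
  by (cases k) (auto intro!: continuous_at_imp_continuous_on differentiable_imp_continuous_within)

lemma Ck_SucD: "Ck (Suc k) F \<Longrightarrow> Ck k F"
proof (induction k arbitrary: F)
  case 0
  then show ?case using Ck_imp_continuous by (metis Ck.simps(1))
next
  case (Suc k)
  then show ?case by (metis Ck.simps(2))
qed

lemma Ck_const: "Ck k (\<lambda>x. c)"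
  by (induction k arbitrary: c) (auto simp: dir_deriv_eqI[OF has_derivative_const])

lemma Ck_add:
  assumes "Ck k F" "Ck k F'"
  shows "Ck k (\<lambda>x. F x + F' x)"
  using assms
proof (induction k arbitrary: F F')
  case 0
  then show ?case by (auto intro: continuous_intros)
next
  case (Suc k)
  have "dir_deriv (\<lambda>x. F x + F' x) v = (\<lambda>x. dir_deriv F v x + dir_deriv F' v x)" for v
    using Suc.prems
    by (intro ext dir_deriv_eqI has_derivative_add) (auto simp: frechet_derivative_works)
  then show ?case using Suc by auto
qed

lemma Ck_scaleR:
  assumes "Ck k a" "Ck k F"
  shows "Ck k (\<lambda>x. a x *\<^sub>R F x)"
  using assms
proof (induction k arbitrary: a F)
  case 0
  then show ?case by (auto intro: continuous_intros)
next
  case (Suc k)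
  have "dir_deriv (\<lambda>x. a x *\<^sub>R F x) v = (\<lambda>x. a x *\<^sub>R dir_deriv F v x + dir_deriv a v x *\<^sub>R F x)" for v
    using Suc.prems
    by (intro ext dir_deriv_eqI has_derivative_scaleR) (auto simp: frechet_derivative_works)
  moreover have "Ck k a" "Ck k F" using Suc.prems by (auto intro: Ck_SucD)
  ultimately show ?case using Suc by (auto intro!: Ck_add)
qed

lemma Ck_bounded_linear_compose:
  assumes "bounded_linear l" "Ck k F"
  shows "Ck k (\<lambda>x. l (F x))"
  using assms(2)
proof (induction k arbitrary: F)
  case 0
  then show ?case
    by (auto intro: bounded_linear.continuous_on[OF assms(1)])
next
  case (Suc k)
  have d: "((\<lambda>x. l (F x)) has_derivative (\<lambda>v. l (dir_deriv F v x))) (at x)" for x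
    using Suc.prems
    by (intro bounded_linear.has_derivative[OF assms(1)]) (auto simp: frechet_derivative_works)
  then have "dir_deriv (\<lambda>x. l (F x)) v = (\<lambda>x. l (dir_deriv F v x))" for v
    by (intro ext dir_deriv_eqI)
  moreover have "(\<lambda>x. l (F x)) differentiable (at x)" for x
    using d differentiable_def by blast
  ultimately show ?case using Suc by auto
qed

lemma smooth_differentiable: "smooth F \<Longrightarrow> F differentiable (at x)"
  unfolding smooth_def by (metis Ck.simps(2))

lemma smooth_has_derivative: "smooth F \<Longrightarrow> (F has_derivative (\<lambda>v. dir_deriv F v x)) (at x)"
  using smooth_differentiable frechet_derivative_works by blast

lemma smooth_dir_deriv: "smooth F \<Longrightarrow> smooth (dir_deriv F v)"
  unfolding smooth_def by (metis Ck.simps(2))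

lemma smooth_continuous: "smooth F \<Longrightarrow> continuous_on S F"
  unfolding smooth_def by (metis Ck.simps(1) continuous_on_subset subset_UNIV)

lemma smooth_const: "smooth (\<lambda>x. c)"
  by (simp add: smooth_def Ck_const)

lemma smooth_add: "smooth F \<Longrightarrow> smooth F' \<Longrightarrow> smooth (\<lambda>x. F x + F' x)"
  by (simp add: smooth_def Ck_add)

lemma smooth_scaleR: "smooth a \<Longrightarrow> smooth F \<Longrightarrow> smooth (\<lambda>x. a x *\<^sub>R F x)"
  by (simp add: smooth_def Ck_scaleR)

lemma smooth_mult:
  fixes a F :: "'a::euclidean_space \<Rightarrow> real"
  shows "smooth a \<Longrightarrow> smooth F \<Longrightarrow> smooth (\<lambda>x. a x * F x)"
  using smooth_scaleR[of a F] by simp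

lemma smooth_diff:
  assumes "smooth F" "smooth F'"
  shows "smooth (\<lambda>x. F x - F' x)"
  using smooth_add[OF assms(1) smooth_scaleR[OF smooth_const[of "-1"] assms(2)]] by simp

lemma smooth_sum: "(\<And>i. i \<in> I \<Longrightarrow> smooth (F i)) \<Longrightarrow> smooth (\<lambda>x. \<Sum>i\<in>I. F i x)"
  by (induction I rule: infinite_finite_induct) (auto intro: smooth_const smooth_add)

lemma smooth_nth: "smooth F \<Longrightarrow> smooth (\<lambda>x. F x $ i)"
  unfolding smooth_def by (auto intro: Ck_bounded_linear_compose[OF bounded_linear_vec_nth])

lemma Ck_bounded_linear:
  assumes "bounded_linear l"
  shows "Ck k l"
proof (cases k)
  case 0
  then show ?thesis using linear_continuous_on[OF assms] by simp
next
  case (Suc m)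
  have d: "(l has_derivative l) (at x)" for x
    using bounded_linear_imp_has_derivative[OF assms] .
  then have "dir_deriv l v = (\<lambda>x. l v)" for v
    by (intro ext dir_deriv_eqI)
  then show ?thesis
    using d by (auto simp: Suc Ck_const differentiable_def)
qed

lemma Ck_compose_bounded_linear:
  assumes l: "bounded_linear l" and F: "Ck k F"
  shows "Ck k (\<lambda>x. F (l x))"
  using F
proof (induction k arbitrary: F)
  case 0
  then show ?case
    using continuous_on_compose2[OF _ linear_continuous_on[OF l]] by (metis Ck.simps(1) subset_UNIV)
next
  case (Suc k)
  have d: "((\<lambda>x. F (l x)) has_derivative (\<lambda>v. dir_deriv F (l v) (l x))) (at x)" for x
    using Suc.prems
    by (intro has_derivative_compose[OF bounded_linear_imp_has_derivative[OF l]])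
      (auto simp: frechet_derivative_works)
  then have "dir_deriv (\<lambda>x. F (l x)) v = (\<lambda>x. dir_deriv F (l v) (l x))" for v
    by (intro ext dir_deriv_eqI)
  moreover have "(\<lambda>x. F (l x)) differentiable (at x)" for x
    using d differentiable_def by blast
  moreover have "Ck k (\<lambda>x. dir_deriv F (l v) (l x))" for v
    using Suc.IH[of "dir_deriv F (l v)"] Suc.prems by simp
  ultimately show ?case by simp
qed

lemma smooth_fst: "smooth fst"
  by (simp add: smooth_def Ck_bounded_linear bounded_linear_fst)

lemma smooth_compose_snd: "smooth F \<Longrightarrow> smooth (\<lambda>p. F (snd p))"
  by (simp add: smooth_def Ck_compose_bounded_linear bounded_linear_snd)

lemma smooth_Pair:
  assumes "smooth F" "smooth F'"
  shows "smooth (\<lambda>x. (F x, F' x))"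
proof -
  have "bounded_linear (\<lambda>a. (a, 0))" "bounded_linear (\<lambda>b. (0, b))"
    by (intro bounded_linear_Pair bounded_linear_ident bounded_linear_zero)+
  then have "smooth (\<lambda>x. (F x, 0) + (0, F' x))"
    using assms by (intro smooth_add) (auto simp: smooth_def intro: Ck_bounded_linear_compose)
  then show ?thesis by simp
qed

text \<open>Along a line, directional derivatives are ordinary derivatives, and the mean value theorem
  applies twice to the second difference
  \<open>\<phi> (x + t v + t w) - \<phi> (x + t v) - \<phi> (x + t w) + \<phi> x\<close>.\<close>

lemma second_difference_mean_value:
  fixes \<phi> :: "'a::euclidean_space \<Rightarrow> real"
  assumes "smooth \<phi>" "t > 0"
  shows "\<exists>p. norm (p - x) \<le> t * (norm v + norm w) \<and>
     \<phi> (x + t *\<^sub>R v + t *\<^sub>R w) - \<phi> (x + t *\<^sub>R v) - \<phi> (x + t *\<^sub>R w) + \<phi> x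
       = t * t * dir_deriv (dir_deriv \<phi> v) w p"
proof -
  have line: "((\<lambda>s. F (a + s *\<^sub>R u)) has_real_derivative dir_deriv F u (a + s *\<^sub>R u)) (at s)"
    if "smooth F" for F :: "'a \<Rightarrow> real" and a u s
  proof -
    have "(F has_derivative frechet_derivative F (at (a + s *\<^sub>R u)))
        (at (a + s *\<^sub>R u) within range (\<lambda>s. a + s *\<^sub>R u))"
      using smooth_has_derivative[OF that] has_derivative_at_withinI by blast
    moreover have "((\<lambda>s. a + s *\<^sub>R u) has_derivative (\<lambda>h. h *\<^sub>R u)) (at s)"
      by (auto intro!: derivative_eq_intros)
    ultimately have "((\<lambda>s. F (a + s *\<^sub>R u)) has_derivative
        (\<lambda>h. frechet_derivative F (at (a + s *\<^sub>R u)) (h *\<^sub>R u))) (at s)"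
      by (rule has_derivative_in_compose[rotated])
    moreover have "frechet_derivative F (at (a + s *\<^sub>R u)) (h *\<^sub>R u)
        = dir_deriv F u (a + s *\<^sub>R u) * h" for h
      using linear_scale[OF linear_frechet_derivative[OF smooth_differentiable[OF that]]]
      by (simp add: mult.commute)
    ultimately show ?thesis
      by (simp add: has_field_derivative_def)
  qed
  have "\<exists>s>0. s < t \<and> (\<phi> (x + t *\<^sub>R w + t *\<^sub>R v) - \<phi> (x + t *\<^sub>R v))
      - (\<phi> (x + t *\<^sub>R w + 0 *\<^sub>R v) - \<phi> (x + 0 *\<^sub>R v))
      = (t - 0) * (dir_deriv \<phi> v (x + t *\<^sub>R w + s *\<^sub>R v) - dir_deriv \<phi> v (x + s *\<^sub>R v))"
    by (rule MVT2[OF assms(2)]) (intro DERIV_diff line assms)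
  then obtain s where s: "0 < s" "s < t"
    and s2: "\<phi> (x + t *\<^sub>R v + t *\<^sub>R w) - \<phi> (x + t *\<^sub>R v) - \<phi> (x + t *\<^sub>R w) + \<phi> x
      = t * (dir_deriv \<phi> v (x + s *\<^sub>R v + t *\<^sub>R w) - dir_deriv \<phi> v (x + s *\<^sub>R v))"
    by (auto simp: algebra_simps)
  have "\<exists>r>0. r < t \<and> dir_deriv \<phi> v (x + s *\<^sub>R v + t *\<^sub>R w) - dir_deriv \<phi> v (x + s *\<^sub>R v + 0 *\<^sub>R w)
      = (t - 0) * dir_deriv (dir_deriv \<phi> v) w (x + s *\<^sub>R v + r *\<^sub>R w)"
    by (rule MVT2[OF assms(2)]) (intro line smooth_dir_deriv assms)
  then obtain r where r: "0 < r" "r < t" and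
    r2: "dir_deriv \<phi> v (x + s *\<^sub>R v + t *\<^sub>R w) - dir_deriv \<phi> v (x + s *\<^sub>R v)
      = t * dir_deriv (dir_deriv \<phi> v) w (x + s *\<^sub>R v + r *\<^sub>R w)"
    by auto
  have "norm ((x + s *\<^sub>R v + r *\<^sub>R w) - x) \<le> norm (s *\<^sub>R v) + norm (r *\<^sub>R w)"
    by (metis add.assoc add_diff_cancel_left' norm_triangle_ineq)
  also have "\<dots> \<le> t * (norm v + norm w)"
    using s r by (simp add: distrib_left add_mono mult_right_mono)
  finally show ?thesis
    using s2 r2 by (metis mult.assoc)
qed

text \<open>The second difference is symmetric in \<open>v\<close> and \<open>w\<close>, so the two mixed derivatives agree at points
  arbitrarily close to \<open>x\<close>, and at \<open>x\<close> by continuity.\<close>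

lemma dir_deriv_commute:
  fixes \<phi> :: "'a::euclidean_space \<Rightarrow> real"
  assumes "smooth \<phi>"
  shows "dir_deriv (dir_deriv \<phi> v) w x = dir_deriv (dir_deriv \<phi> w) v x"
proof -
  let ?t = "\<lambda>k. 1 / real (Suc k)"
  let ?A = "dir_deriv (dir_deriv \<phi> v) w" and ?B = "dir_deriv (dir_deriv \<phi> w) v"
  have "\<exists>p q. norm (p - x) \<le> ?t k * (norm v + norm w) \<and> norm (q - x) \<le> ?t k * (norm v + norm w)
      \<and> ?A p = ?B q" for k
  proof -
    define t where "t = ?t k"
    have "t > 0" by (simp add: t_def)
    obtain p where p: "norm (p - x) \<le> t * (norm v + norm w)"
      "\<phi> (x + t *\<^sub>R v + t *\<^sub>R w) - \<phi> (x + t *\<^sub>R v) - \<phi> (x + t *\<^sub>R w) + \<phi> x = t * t * ?A p"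
      using second_difference_mean_value[OF assms \<open>t > 0\<close>] by blast
    obtain q where q: "norm (q - x) \<le> t * (norm w + norm v)"
      "\<phi> (x + t *\<^sub>R w + t *\<^sub>R v) - \<phi> (x + t *\<^sub>R w) - \<phi> (x + t *\<^sub>R v) + \<phi> x = t * t * ?B q"
      using second_difference_mean_value[OF assms \<open>t > 0\<close>] by blast
    have swap: "x + t *\<^sub>R w + t *\<^sub>R v = x + t *\<^sub>R v + t *\<^sub>R w"
      by (simp add: algebra_simps)
    have "t * t * ?A p = t * t * ?B q"
      using p(2) q(2)[unfolded swap] by linarith
    then have "?A p = ?B q"
      using \<open>t > 0\<close> by simp
    then show ?thesis
      using p q unfolding t_def by (metis add.commute)
  qed
  then obtain p q where p: "\<And>k. norm (p k - x) \<le> ?t k * (norm v + norm w)"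
    and q: "\<And>k. norm (q k - x) \<le> ?t k * (norm v + norm w)" and pq: "\<And>k. ?A (p k) = ?B (q k)"
    by metis
  have lim: "(\<lambda>k. ?t k * (norm v + norm w)) \<longlonglongrightarrow> 0"
    using tendsto_mult_right[OF LIMSEQ_Suc[OF lim_1_over_n], where c = "norm v + norm w"] by simp
  have "(\<lambda>k. p k - x) \<longlonglongrightarrow> 0" "(\<lambda>k. q k - x) \<longlonglongrightarrow> 0"
    using p q by (auto intro!: Lim_null_comparison[OF _ lim] eventuallyI)
  then have lims: "p \<longlonglongrightarrow> x" "q \<longlonglongrightarrow> x"
    by (auto simp: LIM_zero_iff)
  have "isCont ?A x" "isCont ?B x"
    using smooth_continuous[OF smooth_dir_deriv[OF smooth_dir_deriv[OF assms]], of UNIV]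
    by (auto simp: continuous_on_eq_continuous_at)
  then have "(\<lambda>k. ?A (p k)) \<longlonglongrightarrow> ?A x" "(\<lambda>k. ?B (q k)) \<longlonglongrightarrow> ?B x"
    using lims by (auto intro: isCont_tendsto_compose)
  then show ?thesis
    using pq LIMSEQ_unique by auto
qed

section \<open>Lie derivatives and the Jacobian of the normal form\<close>

lemma vec_eq_sum_axis: "v = (\<Sum>i\<in>UNIV. v $ i *\<^sub>R axis i (1::real))"
  using basis_expansion[of v] by (simp add: scalar_mult_eq_scaleR)

lemma frechet_derivative_eq_sum:
  fixes F :: "real ^ 'n \<Rightarrow> 'b::real_normed_vector"
  assumes "F differentiable (at x)"
  shows "dir_deriv F v x = (\<Sum>i\<in>UNIV. v $ i *\<^sub>R dir_deriv F (axis i 1) x)"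
proof -
  have "linear (frechet_derivative F (at x))"
    using linear_frechet_derivative[OF assms] .
  then show ?thesis
    by (subst vec_eq_sum_axis[of v]) (simp add: linear_sum linear_scale)
qed

lemma lie_eq_dir_deriv:
  assumes "smooth h"
  shows "lie f h x = dir_deriv h (f x) x"
  using frechet_derivative_eq_sum[OF smooth_differentiable[OF assms], of x "f x"]
  by (simp add: lie_def mult.commute)

lemma smooth_field_deriv:
  fixes F :: "real ^ 'n \<Rightarrow> 'b::real_normed_vector"
  assumes "smooth F" "smooth f"
  shows "smooth (\<lambda>x. dir_deriv F (f x) x)"
proof -
  have "(\<lambda>x. dir_deriv F (f x) x) = (\<lambda>x. \<Sum>i\<in>UNIV. f x $ i *\<^sub>R dir_deriv F (axis i 1) x)"
    by (intro ext frechet_derivative_eq_sum smooth_differentiable assms)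
  then show ?thesis
    by (simp only:) (intro smooth_sum smooth_scaleR smooth_nth smooth_dir_deriv assms)
qed

lemma smooth_lie: "smooth f \<Longrightarrow> smooth h \<Longrightarrow> smooth (lie f h)"
  using smooth_field_deriv[of h f] by (simp add: lie_eq_dir_deriv[symmetric, of h _ f])

lemma smooth_lie_power: "smooth f \<Longrightarrow> smooth h \<Longrightarrow> smooth ((lie f ^^ j) h)"
  by (induction j) (auto intro: smooth_lie)

definition lie_bracket :: "'n::finite vfield \<Rightarrow> 'n vfield \<Rightarrow> 'n vfield" where
  "lie_bracket f v x = dir_deriv v (f x) x - dir_deriv f (v x) x"

lemma smooth_lie_bracket: "smooth f \<Longrightarrow> smooth v \<Longrightarrow> smooth (lie_bracket f v)"
  unfolding lie_bracket_def[abs_def] by (intro smooth_diff smooth_field_deriv)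

text \<open>The product rule for \<open>L\<^sub>v h = \<Sum> v\<^sub>i \<partial>\<^sub>i h\<close> separates the second derivatives of \<open>h\<close> from the
  derivative of the field.\<close>

lemma lie_lie:
  assumes f: "smooth f" and v: "smooth v" and h: "smooth h"
  shows "lie f (lie v h) x =
    (\<Sum>i\<in>UNIV. \<Sum>j\<in>UNIV. v x $ i * f x $ j * dir_deriv (dir_deriv h (axis i 1)) (axis j 1) x)
    + dir_deriv h (dir_deriv v (f x) x) x"
proof -
  have "((\<lambda>y. \<Sum>i\<in>UNIV. v y $ i *\<^sub>R dir_deriv h (axis i 1) y) has_derivative
      (\<lambda>u. \<Sum>i\<in>UNIV. v x $ i *\<^sub>R dir_deriv (dir_deriv h (axis i 1)) u x
         + (dir_deriv v u x) $ i *\<^sub>R dir_deriv h (axis i 1) x)) (at x)"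
    by (intro has_derivative_sum has_derivative_scaleR smooth_has_derivative smooth_dir_deriv h
        bounded_linear.has_derivative[OF bounded_linear_vec_nth] v)
  moreover have "lie v h = (\<lambda>y. \<Sum>i\<in>UNIV. v y $ i *\<^sub>R dir_deriv h (axis i 1) y)"
    by (auto simp: lie_def mult.commute)
  ultimately have *: "(lie v h has_derivative (\<lambda>u. \<Sum>i\<in>UNIV. v x $ i *\<^sub>R dir_deriv (dir_deriv h (axis i 1)) u x
         + (dir_deriv v u x) $ i *\<^sub>R dir_deriv h (axis i 1) x)) (at x)"
    by simp
  have "lie f (lie v h) x = (\<Sum>i\<in>UNIV. v x $ i *\<^sub>R dir_deriv (dir_deriv h (axis i 1)) (f x) x
         + (dir_deriv v (f x) x) $ i *\<^sub>R dir_deriv h (axis i 1) x)"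
    unfolding lie_eq_dir_deriv[OF smooth_lie[OF v h]] by (rule dir_deriv_eqI[OF *])
  also have "\<dots> = (\<Sum>i\<in>UNIV. v x $ i *\<^sub>R dir_deriv (dir_deriv h (axis i 1)) (f x) x)
      + dir_deriv h (dir_deriv v (f x) x) x"
    by (simp add: sum.distrib
        frechet_derivative_eq_sum[OF smooth_differentiable[OF h], of x "dir_deriv v (f x) x"])
  also have "(\<Sum>i\<in>UNIV. v x $ i *\<^sub>R dir_deriv (dir_deriv h (axis i 1)) (f x) x)
     = (\<Sum>i\<in>UNIV. \<Sum>j\<in>UNIV. v x $ i * f x $ j * dir_deriv (dir_deriv h (axis i 1)) (axis j 1) x)"
  proof (rule sum.cong[OF refl])
    fix i
    show "v x $ i *\<^sub>R dir_deriv (dir_deriv h (axis i 1)) (f x) x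
      = (\<Sum>j\<in>UNIV. v x $ i * f x $ j * dir_deriv (dir_deriv h (axis i 1)) (axis j 1) x)"
      by (subst frechet_derivative_eq_sum[OF smooth_differentiable[OF smooth_dir_deriv[OF h]]])
        (simp add: sum_distrib_left mult.assoc)
  qed
  finally show ?thesis .
qed

text \<open>The second-order terms of \<open>L\<^sub>f L\<^sub>v h\<close> and \<open>L\<^sub>v L\<^sub>f h\<close> are the Hessian of \<open>h\<close> applied to the same
  two vectors, so they cancel by symmetry.\<close>

lemma lie_lie_bracket:
  assumes f: "smooth f" and v: "smooth v" and h: "smooth h"
  shows "lie (lie_bracket f v) h x = lie f (lie v h) x - lie v (lie f h) x"
proof -
  have "(\<Sum>i\<in>UNIV. \<Sum>j\<in>UNIV. v x $ i * f x $ j * dir_deriv (dir_deriv h (axis i 1)) (axis j 1) x)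
     = (\<Sum>j\<in>UNIV. \<Sum>i\<in>UNIV. v x $ i * f x $ j * dir_deriv (dir_deriv h (axis i 1)) (axis j 1) x)"
    by (rule sum.swap)
  also have "\<dots> = (\<Sum>j\<in>UNIV. \<Sum>i\<in>UNIV. f x $ j * v x $ i * dir_deriv (dir_deriv h (axis j 1)) (axis i 1) x)"
    by (intro sum.cong refl) (simp add: dir_deriv_commute[OF h] mult.commute)
  finally have "lie f (lie v h) x - lie v (lie f h) x
     = dir_deriv h (dir_deriv v (f x) x) x - dir_deriv h (dir_deriv f (v x) x) x"
    by (simp add: lie_lie[OF f v h] lie_lie[OF v f h])
  also have "\<dots> = dir_deriv h (lie_bracket f v x) x"
    using linear_diff[OF linear_frechet_derivative[OF smooth_differentiable[OF h]]]
    by (simp add: lie_bracket_def)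
  finally show ?thesis
    by (simp add: lie_eq_dir_deriv[OF h])
qed

lemma lie_zero: "lie f (\<lambda>x. 0) x = 0"
  by (simp add: lie_def dir_deriv_eqI[OF has_derivative_const])

text \<open>Each bracket with \<open>f\<close> moves one Lie derivative from the function to the field, so the
  pairing of \<open>L\<^sub>f\<^sup>i h\<close> with the \<open>k\<close>-th iterated bracket depends, up to sign, on \<open>i + k\<close> only.\<close>

lemma lie_iterated_bracket:
  fixes f g :: "'n::finite vfield"
  assumes f: "smooth f" and g: "smooth g" and h: "smooth h"
    and zero: "\<And>i x. i + 2 \<le> CARD('n) \<Longrightarrow> lie g ((lie f ^^ i) h) x = 0"
  shows "i + k + 2 \<le> CARD('n) \<Longrightarrow> lie ((lie_bracket f ^^ k) g) ((lie f ^^ i) h) x = 0"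
    and "i + k + 1 = CARD('n) \<Longrightarrow>
      lie ((lie_bracket f ^^ k) g) ((lie f ^^ i) h) x = (-1) ^ k * G_fun f g h x"
proof (induction k arbitrary: i x)
  case 0
  { case 1
    then show ?case using zero by simp
  next
    case 2
    then have "i = CARD('n) - 1" by simp
    then show ?case by (simp add: G_fun_def) }
next
  case (Suc k)
  have s: "smooth ((lie_bracket f ^^ k) g)"
    by (induction k) (auto intro: f g smooth_lie_bracket)
  have *: "lie ((lie_bracket f ^^ Suc k) g) ((lie f ^^ i) h) x
      = - lie ((lie_bracket f ^^ k) g) ((lie f ^^ Suc i) h) x" if "i + k + 2 \<le> CARD('n)" for i x
  proof -
    have "lie ((lie_bracket f ^^ k) g) ((lie f ^^ i) h) = (\<lambda>x. 0)"
      using Suc.IH(1)[OF that] by auto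
    then show ?thesis
      using lie_lie_bracket[OF f s smooth_lie_power[OF f h, of i], of x] by (simp add: lie_zero)
  qed
  { case 1
    then show ?case using *[of i x] Suc.IH(1)[of "Suc i" x] by simp
  next
    case 2
    then show ?case using *[of i x] Suc.IH(2)[of "Suc i" x] by simp }
qed

lemma pos_less: "pos (i :: 'n::{finite,linorder}) < CARD('n)"
  using bij_betw_pos[where 'n = 'n] by (auto simp: bij_betw_def)

lemma inj_pos: "inj (pos :: 'n::{finite,linorder} \<Rightarrow> nat)"
  using bij_betw_pos[where 'n = 'n] by (auto simp: bij_betw_def)

lemma ex_pos: "m < CARD('n) \<Longrightarrow> \<exists>i :: 'n::{finite,linorder}. pos i = m"
  using bij_betw_imp_surj_on[OF bij_betw_pos[where 'n = 'n]] by (metis imageE lessThan_iff)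

lemma sum_pos: "(\<Sum>i\<in>(UNIV :: 'n::{finite,linorder} set). q (pos i)) = (\<Sum>j<CARD('n). q j)"
  by (rule sum.reindex_bij_betw[OF bij_betw_pos])

lemma Phi_has_derivative:
  fixes f :: "'n::{finite,linorder} vfield"
  assumes "smooth f" "smooth h"
  shows "(Phi f h has_derivative (\<lambda>v. \<chi> i. dir_deriv ((lie f ^^ pos i) h) v x)) (at x)"
  unfolding has_derivative_componentwise_within[where f = "Phi f h"]
  by (auto simp: Basis_vec_def inner_axis Phi_def
      intro!: smooth_has_derivative smooth_lie_power assms)

lemma dir_deriv_Phi:
  assumes "smooth f" "smooth h"
  shows "dir_deriv (Phi f h) v x $ i = dir_deriv ((lie f ^^ pos i) h) v x"
  by (simp add: dir_deriv_eqI[OF Phi_has_derivative[OF assms]])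

lemma jacobian_Phi:
  assumes "smooth f" "smooth h"
  shows "(Phi f h has_derivative (*v) (jacobian (Phi f h) (at x))) (at x)"
  using jacobian_works Phi_has_derivative[OF assms] differentiable_def by blast

text \<open>Paired with the iterated brackets \<open>g, [f, g], [f, [f, g]], \<dots>\<close>, the rows of the Jacobian form
  a triangular array with \<open>\<plusminus>G\<close> on its anti-diagonal. A vanishing combination of rows
  therefore has all coefficients zero, the last one first.\<close>

lemma invertible_jacobian_Phi:
  fixes f g :: "'n::{finite,linorder} vfield"
  assumes f: "smooth f" and g: "smooth g" and h: "smooth h"
    and rel: "uniform_relative_degree f g h"
  shows "invertible (jacobian (Phi f h) (at x))"
proof -
  let ?J = "jacobian (Phi f h) (at x)"
  have zero: "\<And>i x. i + 2 \<le> CARD('n) \<Longrightarrow> lie g ((lie f ^^ i) h) x = 0"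
    and G: "G_fun f g h x \<noteq> 0"
    using rel by (auto simp: uniform_relative_degree_def)
  have Jv: "(?J *v v) $ i = dir_deriv ((lie f ^^ pos i) h) v x" for v i
    using dir_deriv_eqI[OF jacobian_Phi[OF f h], of x v] dir_deriv_Phi[OF f h, of x v i] by simp
  have "c = 0" if c: "transpose ?J *v c = 0" for c
  proof -
    have comb: "(\<Sum>i\<in>UNIV. c $ i * lie v ((lie f ^^ pos i) h) x) = 0" for v
    proof -
      have "(\<Sum>i\<in>UNIV. c $ i * lie v ((lie f ^^ pos i) h) x) = c \<bullet> (?J *v v x)"
        by (simp add: inner_vec_def Jv lie_eq_dir_deriv[OF smooth_lie_power[OF f h]])
      also have "\<dots> = (transpose ?J *v c) \<bullet> v x"
        by (simp add: dot_lmul_matrix)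
      finally show ?thesis using c by simp
    qed
    have "\<forall>i. pos i + k + 1 = CARD('n) \<longrightarrow> c $ i = 0" for k
    proof (induction k rule: less_induct)
      case (less k)
      show ?case
      proof (intro allI impI)
        fix i :: 'n assume i: "pos i + k + 1 = CARD('n)"
        let ?v = "(lie_bracket f ^^ k) g"
        have "c $ j * lie ?v ((lie f ^^ pos j) h) x
          = (if j = i then c $ i * ((-1) ^ k * G_fun f g h x) else 0)" for j
        proof (cases "j = i")
          case True
          then show ?thesis using lie_iterated_bracket(2)[OF f g h zero, OF _ i] by simp
        next
          case False
          then have "pos j \<noteq> pos i" using inj_pos by (metis injD)
          then consider "pos j + k + 2 \<le> CARD('n)" | "pos i < pos j"
            using i by linarith
          then show ?thesis
          proof cases
            case 1
            then show ?thesis using False lie_iterated_bracket(1)[OF f g h zero] by simp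
          next
            case 2
            then have "CARD('n) - 1 - pos j < k" "pos j + (CARD('n) - 1 - pos j) + 1 = CARD('n)"
              using i pos_less[of j] by linarith+
            then have "c $ j = 0" using less by blast
            then show ?thesis using False by simp
          qed
        qed
        then have "c $ i * ((-1) ^ k * G_fun f g h x) = 0"
          using comb[of ?v] by simp
        then show "c $ i = 0" using G by simp
      qed
    qed
    moreover have "\<exists>k. pos i + k + 1 = CARD('n)" for i :: 'n
      using pos_less[of i] by (metis add.assoc less_iff_Suc_add Suc_eq_plus1 add_Suc_right)
    ultimately have "c $ i = 0" for i
      by blast
    then show ?thesis by (simp add: vec_eq_iff)
  qed
  then have "\<exists>B. B ** transpose ?J = mat 1"
    by (simp add: matrix_left_invertible_ker)
  then have "invertible (transpose ?J)"
    by (simp add: invertible_left_inverse)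
  then show ?thesis
    using transpose_invertible[of "transpose ?J"] by (simp add: transpose_transpose)
qed

lemma matrix_inv_mult_left:
  assumes "invertible A"
  shows "matrix_inv A ** A = mat 1"
  using someI_ex[of "\<lambda>A'. A ** A' = mat 1 \<and> A' ** A = mat 1"] assms
  unfolding invertible_def matrix_inv_def by blast

section \<open>Global existence for ordinary differential equations\<close>

text \<open>A one-sided Gronwall estimate: the sign condition makes \<open>\<phi> t exp (- c t)\<close> nonincreasing.\<close>

lemma differential_inequality:
  fixes \<phi> \<phi>' :: "real \<Rightarrow> real"
  assumes deriv: "\<And>t. t \<in> {0..T} \<Longrightarrow> (\<phi> has_real_derivative \<phi>' t) (at t within {0..T})"
    and le: "\<And>t. t \<in> {0..T} \<Longrightarrow> \<phi>' t \<le> c * \<phi> t"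
    and s: "s \<in> {0..T}"
  shows "\<phi> s \<le> \<phi> 0 * exp (c * s)"
proof -
  let ?\<psi> = "\<lambda>t. \<phi> t * exp (- c * t)"
  have d: "(?\<psi> has_real_derivative (\<phi>' t - c * \<phi> t) * exp (- c * t)) (at t within {0..T})"
    if "t \<in> {0..T}" for t
    by (rule derivative_eq_intros deriv that | simp add: algebra_simps)+
  have "?\<psi> s \<le> ?\<psi> 0"
  proof (rule DERIV_nonpos_imp_decreasing_open[where f = ?\<psi>])
    show "0 \<le> s" using s by simp
    show "\<exists>y. DERIV ?\<psi> t :> y \<and> y \<le> 0" if "0 < t" "t < s" for t
    proof -
      have "t \<in> interior {0..T}" using that s by simp
      then have "DERIV ?\<psi> t :> (\<phi>' t - c * \<phi> t) * exp (- c * t)"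
        using d[of t] that s at_within_interior[of t "{0..T}"] by simp
      moreover have "(\<phi>' t - c * \<phi> t) * exp (- c * t) \<le> 0"
        using le[of t] that s by (simp add: mult_nonpos_nonneg)
      ultimately show ?thesis by blast
    qed
    show "continuous_on {0..s} ?\<psi>"
      using s d by (intro continuous_on_subset[OF DERIV_continuous_on[of "{0..T}"]]) auto
  qed
  then show ?thesis
    by (simp add: exp_minus field_simps)
qed

definition solution_on :: "('a::euclidean_space \<Rightarrow> 'a) \<Rightarrow> real \<Rightarrow> (real \<Rightarrow> 'a) \<Rightarrow> bool" where
  "solution_on F T x \<longleftrightarrow> (\<forall>t\<in>{0..T}. (x has_vector_derivative F (x t)) (at t within {0..T}))"

lemma solution_on_continuous: "solution_on F T x \<Longrightarrow> continuous_on {0..T} x"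
  unfolding solution_on_def
  by (intro continuous_on_vector_derivative) auto

lemma solution_on_subset: "solution_on F T x \<Longrightarrow> S \<le> T \<Longrightarrow> solution_on F S x"
  unfolding solution_on_def
  by (auto intro: has_vector_derivative_within_subset[of _ _ _ "{0..T}" "{0..S}"])

definition lipschitz_on_balls :: "('a::real_normed_vector \<Rightarrow> 'b::real_normed_vector) \<Rightarrow> bool" where
  "lipschitz_on_balls F \<longleftrightarrow> (\<forall>r. \<exists>K. K-lipschitz_on (cball 0 r) F)"

text \<open>Each further iteration integrates the previous bound and contributes a factor \<open>K\<close>.\<close>

lemma Picard_iterates_bound:
  fixes F :: "'a::euclidean_space \<Rightarrow> 'a"
  assumes lip: "K-lipschitz_on UNIV F"
    and X0: "X 0 = (\<lambda>t. p)"
    and XS: "\<And>n. X (Suc n) = (\<lambda>t. p + integral {0..t} (\<lambda>s. F (X n s)))"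
    and cont: "\<And>n T. continuous_on {0..T} (X n)"
    and t: "0 \<le> t"
  shows "norm (X (Suc n) t - X n t) \<le> norm (F p) * K ^ n * t ^ Suc n / fact (Suc n)"
  using t
proof (induction n arbitrary: t)
  case 0
  then show ?case by (simp add: X0 XS mult.commute)
next
  case (Suc n)
  let ?c = "norm (F p) * K ^ Suc n"
  have contF: "continuous_on {0..t} (\<lambda>s. F (X n s))" for n
    by (rule continuous_on_compose2[OF lipschitz_on_continuous_on[OF lip] cont]) auto
  have "((\<lambda>s. ?c * s ^ Suc n / fact (Suc n)) has_integral
      ?c * t ^ Suc (Suc n) / fact (Suc (Suc n)) - ?c * 0 ^ Suc (Suc n) / fact (Suc (Suc n))) {0..t}"
  proof (rule fundamental_theorem_of_calculus[OF Suc.prems])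
    fix s
    have "((\<lambda>s. ?c * s ^ Suc (Suc n) / fact (Suc (Suc n))) has_real_derivative
        ?c * (real (Suc (Suc n)) * s ^ Suc n) / fact (Suc (Suc n))) (at s within {0..t})"
      by (rule derivative_eq_intros refl | simp)+
    moreover have "?c * (real (Suc (Suc n)) * s ^ Suc n) / fact (Suc (Suc n))
        = ?c * s ^ Suc n / fact (Suc n)"
      by (simp only: fact_Suc[of "Suc n"] of_nat_mult) (simp add: field_simps del: of_nat_Suc fact_Suc power_Suc)
    ultimately show "((\<lambda>s. ?c * s ^ Suc (Suc n) / fact (Suc (Suc n))) has_vector_derivative
        ?c * s ^ Suc n / fact (Suc n)) (at s within {0..t})"
      by (simp only: has_real_derivative_iff_has_vector_derivative)
  qed
  then have int: "((\<lambda>s. ?c * s ^ Suc n / fact (Suc n)) has_integral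
      ?c * t ^ Suc (Suc n) / fact (Suc (Suc n))) {0..t}"
    by simp
  have "X (Suc (Suc n)) t - X (Suc n) t = integral {0..t} (\<lambda>s. F (X (Suc n) s) - F (X n s))"
    unfolding XS[of "Suc n"] XS[of n, THEN fun_cong, of t]
    by (simp add: integral_diff integrable_continuous_real contF)
  also have "norm \<dots> \<le> integral {0..t} (\<lambda>s. ?c * s ^ Suc n / fact (Suc n))"
  proof (rule integral_norm_bound_integral)
    show "(\<lambda>s. F (X (Suc n) s) - F (X n s)) integrable_on {0..t}"
      by (intro integrable_continuous_real continuous_on_diff contF)
    show "(\<lambda>s. ?c * s ^ Suc n / fact (Suc n)) integrable_on {0..t}"
      using int by blast
    fix s assume "s \<in> {0..t}"
    then have "norm (X (Suc n) s - X n s) \<le> norm (F p) * K ^ n * s ^ Suc n / fact (Suc n)"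
      using Suc.IH[of s] by simp
    then have "K * norm (X (Suc n) s - X n s) \<le> K * (norm (F p) * K ^ n * s ^ Suc n / fact (Suc n))"
      using lipschitz_on_nonneg[OF lip] by (rule mult_left_mono)
    then show "norm (F (X (Suc n) s) - F (X n s)) \<le> ?c * s ^ Suc n / fact (Suc n)"
      using lipschitz_on_normD[OF lip, of "X (Suc n) s" "X n s"]
      by (simp add: mult.assoc mult.left_commute del: fact_Suc)
  qed
  also have "\<dots> = ?c * t ^ Suc (Suc n) / fact (Suc (Suc n))"
    using int by (rule integral_unique)
  finally show ?case .
qed

text \<open>The factorial in the bound on successive Picard iterates makes them converge on every compact
  interval at once, so no step-by-step continuation is needed.\<close>

lemma global_solution_if_lipschitz:
  fixes F :: "'a::euclidean_space \<Rightarrow> 'a"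
  assumes lip: "K-lipschitz_on UNIV F"
  shows "\<exists>x. x 0 = p \<and> (\<forall>T. solution_on F T x)"
proof -
  define X :: "nat \<Rightarrow> real \<Rightarrow> 'a" where "X = rec_nat (\<lambda>t. p) (\<lambda>n y t. p + integral {0..t} (\<lambda>s. F (y s)))"
  have X0: "X 0 = (\<lambda>t. p)" and XS: "X (Suc n) = (\<lambda>t. p + integral {0..t} (\<lambda>s. F (X n s)))" for n
    by (auto simp: X_def)
  have contF: "continuous_on {0..T} (\<lambda>s. F (y s))" if "continuous_on {0..T} y" for T and y :: "real \<Rightarrow> 'a"
    by (rule continuous_on_compose2[OF lipschitz_on_continuous_on[OF lip] that]) auto
  have cont: "continuous_on {0..T} (X n)" for n T
  proof (induction n)
    case (Suc n)
    show ?case unfolding XS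
      by (rule continuous_on_add[OF continuous_on_const
            indefinite_integral_continuous_1[OF integrable_continuous_real[OF contF[OF Suc]]]])
  qed (simp add: X0)
  define x where "x t = p + (\<Sum>n. X (Suc n) t - X n t)" for t
  have lim: "uniform_limit {0..T} X x sequentially" for T
  proof (cases "0 \<le> T")
    case True
    let ?M = "\<lambda>n. norm (F p) * K ^ n * T ^ Suc n / fact (Suc n)"
    have K: "0 \<le> K" using lipschitz_on_nonneg[OF lip] .
    have "?M n \<le> norm (F p) * T * (inverse (fact n) * (K * T) ^ n)" for n
    proof -
      have "norm (F p) * K ^ n * T ^ Suc n = norm (F p) * T * (K * T) ^ n"
        by (simp add: power_mult_distrib)
      moreover have "\<dots> / fact (Suc n) \<le> norm (F p) * T * (K * T) ^ n / fact n"
        using True K by (intro divide_left_mono mult_nonneg_nonneg fact_mono) auto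
      ultimately show ?thesis
        by (simp only: divide_inverse mult.assoc mult.commute[of "inverse _"])
    qed
    moreover have "0 \<le> ?M n" for n
      using True K by simp
    ultimately have "norm (?M n) \<le> norm (F p) * T * (inverse (fact n) * (K * T) ^ n)" for n
      by (metis abs_of_nonneg real_norm_def)
    then have "summable ?M"
      by (intro summable_comparison_test'[OF summable_mult[OF summable_exp], of 0])
    moreover have "norm (X (Suc n) t - X n t) \<le> ?M n" if "t \<in> {0..T}" for n t
    proof -
      have "norm (X (Suc n) t - X n t) \<le> norm (F p) * K ^ n * t ^ Suc n / fact (Suc n)"
        using Picard_iterates_bound[OF lip X0 XS cont] that by simp
      also have "\<dots> \<le> ?M n"
        using that K by (intro divide_right_mono mult_left_mono power_mono) auto
      finally show ?thesis .
    qed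
    ultimately have "uniform_limit {0..T} (\<lambda>N t. \<Sum>n<N. X (Suc n) t - X n t)
        (\<lambda>t. \<Sum>n. X (Suc n) t - X n t) sequentially"
      by (intro Weierstrass_m_test)
    then have "uniform_limit {0..T} (\<lambda>N t. p + (\<Sum>n<N. X (Suc n) t - X n t))
        (\<lambda>t. p + (\<Sum>n. X (Suc n) t - X n t)) sequentially"
      by (intro uniform_limit_intros)
    moreover have "(\<lambda>N t. p + (\<Sum>n<N. X (Suc n) t - X n t)) = X"
    proof (intro ext)
      show "p + (\<Sum>n<N. X (Suc n) t - X n t) = X N t" for N t
        using sum_lessThan_telescope[of "\<lambda>n. X n t" N] by (simp add: X0)
    qed
    ultimately show ?thesis by (simp add: x_def[abs_def])
  qed simp
  have contx: "continuous_on {0..T} x" for T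
    using uniform_limit_theorem[OF _ lim] cont by (simp add: eventuallyI)
  have int_eq: "x t = p + integral {0..t} (\<lambda>s. F (x s))" if "0 \<le> t" for t
  proof -
    have "uniform_limit {0..t} (\<lambda>n s. F (X n s)) (\<lambda>s. F (x s)) sequentially"
      by (rule uniform_limit_compose_uniformly_continuous_on[OF lim
            lipschitz_on_uniformly_continuous[OF lip]]) auto
    then obtain I J where I: "\<And>n. ((\<lambda>s. F (X n s)) has_integral I n) {0..t}"
      and J: "((\<lambda>s. F (x s)) has_integral J) {0..t}" and IJ: "I \<longlonglongrightarrow> J"
      using contF[OF cont] by (rule uniform_limit_integral) auto
    have "(\<lambda>n. X (Suc n) t) \<longlonglongrightarrow> p + integral {0..t} (\<lambda>s. F (x s))"
      unfolding XS integral_unique[OF I] integral_unique[OF J] by (intro tendsto_intros IJ)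
    moreover have "(\<lambda>n. X (Suc n) t) \<longlonglongrightarrow> x t"
      using tendsto_uniform_limitI[OF lim[of t], of t] that by (intro LIMSEQ_Suc) auto
    ultimately show ?thesis
      using LIMSEQ_unique by blast
  qed
  have "solution_on F T x" for T
    unfolding solution_on_def
  proof
    fix t assume t: "t \<in> {0..T}"
    have "((\<lambda>t. p + integral {0..t} (\<lambda>s. F (x s))) has_vector_derivative 0 + F (x t)) (at t within {0..T})"
      by (intro has_vector_derivative_add has_vector_derivative_const
          integral_has_vector_derivative contF contx t)
    then show "(x has_vector_derivative F (x t)) (at t within {0..T})"
      by (intro has_vector_derivative_transform[OF t, of x]) (auto intro: int_eq)
  qed
  moreover have "x 0 = p"
    using int_eq[of 0] by simp
  ultimately show ?thesis by blast
qed

text \<open>Both solutions stay in a common ball on the compact interval, where the Lipschitz constant of \<open>F\<close>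
  bounds the growth rate of their squared distance.\<close>

lemma solution_unique:
  fixes F :: "'a::euclidean_space \<Rightarrow> 'a"
  assumes F: "lipschitz_on_balls F"
    and x: "solution_on F T x" and y: "solution_on F T y" and init: "x 0 = y 0"
    and t: "t \<in> {0..T}"
  shows "x t = y t"
proof -
  have "bounded (x ` {0..T})" "bounded (y ` {0..T})"
    using solution_on_continuous x y by (auto intro!: compact_imp_bounded compact_continuous_image)
  then obtain r where r: "\<And>s. s \<in> {0..T} \<Longrightarrow> norm (x s) \<le> r" "\<And>s. s \<in> {0..T} \<Longrightarrow> norm (y s) \<le> r"
    unfolding bounded_iff by (metis image_eqI max.cobounded1 max.cobounded2 order_trans)
  obtain K where K: "K-lipschitz_on (cball 0 r) F"
    using F by (auto simp: lipschitz_on_balls_def)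
  let ?\<phi> = "\<lambda>s. (x s - y s) \<bullet> (x s - y s)"
  have "?\<phi> t \<le> ?\<phi> 0 * exp ((2 * K) * t)"
  proof (rule differential_inequality[OF _ _ t])
    fix s assume s: "s \<in> {0..T}"
    have "((\<lambda>s. x s - y s) has_vector_derivative F (x s) - F (y s)) (at s within {0..T})"
      using x y s by (intro has_vector_derivative_diff) (auto simp: solution_on_def)
    then have d: "((\<lambda>s. x s - y s) has_derivative (\<lambda>h. h *\<^sub>R (F (x s) - F (y s)))) (at s within {0..T})"
      by (simp add: has_vector_derivative_def)
    show "(?\<phi> has_real_derivative 2 * ((x s - y s) \<bullet> (F (x s) - F (y s)))) (at s within {0..T})"
      unfolding has_field_derivative_def
      by (rule has_derivative_eq_rhs[OF has_derivative_inner[OF d d]])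
        (simp add: inner_commute mult.commute fun_eq_iff)
    have "(x s - y s) \<bullet> (F (x s) - F (y s)) \<le> norm (x s - y s) * norm (F (x s) - F (y s))"
      by (rule norm_cauchy_schwarz)
    also have "\<dots> \<le> norm (x s - y s) * (K * norm (x s - y s))"
      using r[OF s] by (intro mult_left_mono lipschitz_on_normD[OF K]) auto
    finally show "2 * ((x s - y s) \<bullet> (F (x s) - F (y s))) \<le> 2 * K * ?\<phi> s"
      by (simp add: dot_square_norm power2_eq_square mult_ac)
  qed
  then show ?thesis
    using init by (metis antisym diff_self eq_iff_diff_eq_0 inner_eq_zero_iff inner_ge_zero inner_zero_left
        mult_zero_left)
qed

text \<open>Composing \<open>F\<close> with the projection onto a ball makes it globally Lipschitz. The a priori bound
  keeps the resulting solution inside the ball, where the projection is the identity: a first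
  exit time would be reached by a genuine solution of norm larger than the bound.\<close>

lemma solution_exists_if_bounded:
  fixes F :: "'a::euclidean_space \<Rightarrow> 'a"
  assumes F: "lipschitz_on_balls F" and T: "0 \<le> T"
    and bound: "\<And>S x. S \<in> {0..T} \<Longrightarrow> x 0 = p \<Longrightarrow> solution_on F S x \<Longrightarrow> norm (x S) \<le> R"
  shows "\<exists>x. x 0 = p \<and> solution_on F T x"
proof -
  let ?B = "cball 0 (R + 1) :: 'a set"
  have "solution_on F 0 (\<lambda>t. p)"
    by (simp add: solution_on_def has_vector_derivative_def has_derivative_within_singleton_iff
        bounded_linear_scaleR_left)
  then have pR: "norm p \<le> R"
    using bound[of 0 "\<lambda>t. p"] T by simp
  then have B: "convex ?B" "closed ?B" "?B \<noteq> {}"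
    using order_trans[OF norm_ge_zero pR] by auto
  obtain K where K: "K-lipschitz_on ?B F"
    using F by (auto simp: lipschitz_on_balls_def)
  let ?P = "closest_point ?B"
  have "1-lipschitz_on UNIV ?P"
    using closest_point_lipschitz[OF B] by (intro lipschitz_onI) auto
  moreover have "?P ` UNIV \<subseteq> ?B"
    using closest_point_in_set[OF B(2,3)] by auto
  ultimately have "(K * 1)-lipschitz_on UNIV (\<lambda>y. F (?P y))"
    by (intro lipschitz_on_compose2 lipschitz_on_subset[OF K])
  then obtain x where x0: "x 0 = p" and x: "\<And>T. solution_on (\<lambda>y. F (?P y)) T x"
    using global_solution_if_lipschitz by blast
  have stay: "solution_on F S x" if "\<And>t. t \<in> {0..S} \<Longrightarrow> norm (x t) \<le> R + 1" for S
    using x[of S] that unfolding solution_on_def by (simp add: closest_point_self)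
  have "norm (x t) \<le> R + 1" if t: "t \<in> {0..T}" for t
  proof (rule ccontr)
    assume "\<not> ?thesis"
    then have t1: "R + 1 < norm (x t)" by simp
    let ?A = "{s \<in> {0..T}. R + 1 \<le> norm (x s)}"
    have "closed ({0..T} \<inter> (\<lambda>s. norm (x s)) -` {R + 1..})"
      using solution_on_continuous[OF x[of T]]
      by (intro continuous_closed_preimage continuous_on_norm) auto
    moreover have "?A = {0..T} \<inter> (\<lambda>s. norm (x s)) -` {R + 1..}"
      by auto
    ultimately have "closed ?A"
      by simp
    moreover have "t \<in> ?A" "bdd_below ?A"
      using t t1 by auto
    ultimately have m: "Inf ?A \<in> ?A"
      by (intro closed_contains_Inf) auto
    have "norm (x s) \<le> R + 1" if s: "s \<in> {0..Inf ?A}" for s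
    proof (rule ccontr)
      assume *: "\<not> ?thesis"
      have "continuous_on {0..s} (\<lambda>s. norm (x s))"
        using solution_on_continuous[OF x[of s]] by (intro continuous_intros)
      then obtain r where r: "0 \<le> r" "r \<le> s" "norm (x r) = R + 1"
        using IVT'[of "\<lambda>s. norm (x s)" 0 "R + 1" s] * pR x0 s by auto
      then have "r \<in> ?A" using s m by auto
      then have "Inf ?A \<le> r" using \<open>bdd_below ?A\<close> by (rule cInf_lower)
      then have "r = s" using r s by auto
      then show False using r * by simp
    qed
    then have "solution_on F (Inf ?A) x"
      by (rule stay)
    then have "norm (x (Inf ?A)) \<le> R"
      using bound[of "Inf ?A" x] m x0 by simp
    then show False using m by simp
  qed
  then show ?thesis using stay x0 by blast
qed

text \<open>The solutions on \<open>[0, N]\<close> agree on common domains by uniqueness and are glued together.\<close>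

lemma global_solution_if_bounded:
  fixes F :: "'a::euclidean_space \<Rightarrow> 'a"
  assumes F: "lipschitz_on_balls F"
    and bound: "\<And>T. 0 \<le> T \<Longrightarrow>
      \<exists>R. \<forall>S\<in>{0..T}. \<forall>x. x 0 = p \<longrightarrow> solution_on F S x \<longrightarrow> norm (x S) \<le> R"
  shows "\<exists>x. x 0 = p \<and> (\<forall>t\<ge>0. (x has_vector_derivative F (x t)) (at t within {0..}))"
proof -
  have "\<exists>x. x 0 = p \<and> solution_on F (real N) x" for N
    using bound[of "real N"] solution_exists_if_bounded[OF F, of "real N" p] by fastforce
  then obtain X where X0: "\<And>N. X N 0 = p" and X: "\<And>N. solution_on F (real N) (X N)"
    by metis
  have agree: "X M t = X N t" if "0 \<le> t" "t \<le> real M" "t \<le> real N" for M N t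
    using solution_unique[OF F, of t "X M" "X N" t] X0 X that
    by (auto intro: solution_on_subset)
  define x where "x t = X (nat \<lceil>t\<rceil>) t" for t
  have x_eq: "x t = X N t" if "0 \<le> t" "t \<le> real N" for t N
    unfolding x_def using that by (intro agree) (auto simp: real_nat_ceiling_ge)
  have "(x has_vector_derivative F (x t)) (at t within {0..})" if t: "0 \<le> t" for t
  proof -
    (* one more than the ceiling, so that t lies in the relative interior of the interval *)
    define N where "N = nat \<lceil>t\<rceil> + 1"
    have tN: "t < real N"
      unfolding N_def using real_nat_ceiling_ge[of t] by simp
    have "(X N has_vector_derivative F (X N t)) (at t within {0..real N})"
      using X[of N] t tN by (auto simp: solution_on_def)
    moreover have "at t within {0..real N} = at t within {0..}"
      using tN by (intro at_within_nhd[of t "{..<real N}"]) auto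
    ultimately have "(X N has_vector_derivative F (x t)) (at t within {0..})"
      using x_eq[of t N] t tN by simp
    then show ?thesis
      by (rule has_vector_derivative_transform_within[where d = "real N - t"])
        (use t tN x_eq[of _ N] in \<open>auto simp: dist_real_def\<close>)
  qed
  moreover have "x 0 = p" using x_eq[of 0 0] X0 by simp
  ultimately show ?thesis by blast
qed

text \<open>On a ball, the directional derivatives along the basis vectors are bounded by compactness, and
  together they bound the operator norm of the derivative.\<close>

lemma smooth_lipschitz_on_balls:
  assumes F: "smooth F"
  shows "lipschitz_on_balls F"
  unfolding lipschitz_on_balls_def
proof
  fix r :: real
  have "\<exists>B. \<forall>x\<in>cball 0 r. norm (dir_deriv F b x) \<le> B" for b
  proof -
    have "compact (dir_deriv F b ` cball 0 r)"
      by (intro compact_continuous_image smooth_continuous smooth_dir_deriv F compact_cball)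
    then show ?thesis
      using compact_imp_bounded[of "dir_deriv F b ` cball 0 r"] by (auto simp: bounded_iff)
  qed
  then obtain B where B: "\<And>b x. x \<in> cball 0 r \<Longrightarrow> norm (dir_deriv F b x) \<le> B b"
    by metis
  let ?K = "\<Sum>b\<in>Basis. \<bar>B b\<bar>"
  have "?K-lipschitz_on (cball 0 r) F"
  proof (rule bounded_derivative_imp_lipschitz)
    fix x :: 'a assume x: "x \<in> cball 0 r"
    show "(F has_derivative frechet_derivative F (at x)) (at x within cball 0 r)"
      using smooth_has_derivative[OF F] has_derivative_at_withinI by blast
    show "onorm (frechet_derivative F (at x)) \<le> ?K"
    proof (rule onorm_le)
      fix v
      have lin: "linear (frechet_derivative F (at x))"
        using linear_frechet_derivative smooth_differentiable[OF F] by blast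
      have "dir_deriv F v x = (\<Sum>b\<in>Basis. (v \<bullet> b) *\<^sub>R dir_deriv F b x)"
        by (subst euclidean_representation[of v, symmetric]) (simp add: linear_sum[OF lin] linear_scale[OF lin])
      also have "norm \<dots> \<le> (\<Sum>b\<in>Basis. norm v * \<bar>B b\<bar>)"
        using B[OF x] by (intro sum_norm_le) (auto intro!: mult_mono Basis_le_norm intro: order_trans[OF _ abs_ge_self])
      finally show "norm (dir_deriv F v x) \<le> ?K * norm v"
        by (simp add: sum_distrib_left mult.commute)
    qed
  qed (auto intro: sum_nonneg)
  then show "\<exists>K. K-lipschitz_on (cball 0 r) F" by blast
qed

text \<open>The logarithm of \<open>e + \<parallel>x\<parallel>\<^sup>2\<close> satisfies a linear differential inequality, which rules out
  blow-up in finite time.\<close>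

lemma norm_bound_if_log_growth:
  fixes x v :: "real \<Rightarrow> 'a::euclidean_space"
  assumes x: "\<And>t. t \<in> {0..T} \<Longrightarrow> (x has_vector_derivative v t) (at t within {0..T})"
    and v: "\<And>t. t \<in> {0..T} \<Longrightarrow> norm (v t) \<le> a * norm (x t) * ln (norm (x t)) + b"
    and ab: "0 \<le> a" "0 \<le> b" and t: "t \<in> {0..T}"
  shows "norm (x t) \<le> exp (ln (exp 1 + (norm (x 0))\<^sup>2) * exp ((a + b) * t))"
proof -
  let ?q = "\<lambda>t. exp 1 + x t \<bullet> x t"
  have q: "exp 1 \<le> ?q t" for t
    by simp
  then have q_pos: "0 < ?q t" for t
    using exp_gt_zero[of "1::real"] by (rule less_le_trans[rotated])
  have "ln (exp 1) \<le> ln (?q t)" for t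
    using q[of t] q_pos[of t] by (subst ln_le_cancel_iff) auto
  then have ln_q: "1 \<le> ln (?q t)" for t
    by simp
  have two_norm_le: "2 * norm (x t) \<le> ?q t" for t
  proof -
    have "2 * norm (x t) \<le> 1 + x t \<bullet> x t"
      using sum_squares_bound[of "norm (x t)" 1] by (simp add: power2_norm_eq_inner)
    moreover have "1 \<le> exp (1::real)" by simp
    ultimately show ?thesis by linarith
  qed
  have "ln (?q t) \<le> ln (?q 0) * exp ((a + b) * t)"
  proof (rule differential_inequality[OF _ _ t])
    fix t assume t: "t \<in> {0..T}"
    let ?r = "norm (x t)"
    have d: "(x has_derivative (\<lambda>h. h *\<^sub>R v t)) (at t within {0..T})"
      using x[OF t] by (simp add: has_vector_derivative_def)
    have "((\<lambda>t. x t \<bullet> x t) has_real_derivative 2 * (x t \<bullet> v t)) (at t within {0..T})"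
      unfolding has_field_derivative_def
      by (rule has_derivative_eq_rhs[OF has_derivative_inner[OF d d]])
        (simp add: inner_commute mult.commute fun_eq_iff)
    then show "((\<lambda>t. ln (?q t)) has_real_derivative 2 * (x t \<bullet> v t) / ?q t) (at t within {0..T})"
      using q_pos[of t] by (auto intro!: derivative_eq_intros)
    have rq: "?r\<^sup>2 \<le> ?q t"
      by (simp add: power2_norm_eq_inner)
    have qln: "?q t \<le> ?q t * ln (?q t)"
      using ln_q[of t] q_pos[of t] by simp
    have "2 * (?r\<^sup>2 * ln ?r) \<le> ?q t * ln (?q t)"
    proof (cases "1 \<le> ?r")
      case True
      then have "2 * (?r\<^sup>2 * ln ?r) = ?r\<^sup>2 * ln (?r\<^sup>2)"
        by (subst ln_realpow) auto
      also have "\<dots> \<le> ?q t * ln (?q t)"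
      proof (intro mult_mono rq)
        have "0 < ?r\<^sup>2" using True by (intro zero_less_power) linarith
        then show "ln (?r\<^sup>2) \<le> ln (?q t)"
          using rq q_pos[of t] by (subst ln_le_cancel_iff) auto
        show "0 \<le> ln (?r\<^sup>2)" using True by (intro ln_ge_zero) (simp add: one_le_power)
      qed (use q_pos[of t] in auto)
      finally show ?thesis .
    next
      case False
      then have "?r\<^sup>2 * ln ?r \<le> 0"
        by (cases "?r = 0") (auto intro!: mult_nonneg_nonpos)
      then show ?thesis
        using ln_q[of t] q_pos[of t] by (smt (verit) mult_nonneg_nonneg)
    qed
    then have 1: "a * (2 * (?r\<^sup>2 * ln ?r)) \<le> a * (?q t * ln (?q t))"
      by (rule mult_left_mono[OF _ ab(1)])
    have "2 * ?r \<le> ?q t"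
      using two_norm_le[of t] norm_ge_zero[of "x t"] by linarith
    then have 2: "b * (2 * ?r) \<le> b * (?q t * ln (?q t))"
      using qln by (intro mult_left_mono[OF _ ab(2)]) linarith
    have "x t \<bullet> v t \<le> ?r * norm (v t)"
      by (rule norm_cauchy_schwarz)
    also have "\<dots> \<le> ?r * (a * ?r * ln ?r + b)"
      using v[OF t] by (intro mult_left_mono) auto
    finally have "2 * (x t \<bullet> v t) \<le> a * (2 * (?r\<^sup>2 * ln ?r)) + b * (2 * ?r)"
      by (simp add: algebra_simps power2_eq_square)
    also have "\<dots> \<le> (a + b) * ln (?q t) * ?q t"
      using 1 2 by (simp add: algebra_simps)
    finally show "2 * (x t \<bullet> v t) / ?q t \<le> (a + b) * ln (?q t)"
      using q_pos[of t] by (simp add: pos_divide_le_eq)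
  qed
  then have "?q t \<le> exp (ln (?q 0) * exp ((a + b) * t))"
    using q_pos[of t] by (metis exp_le_cancel_iff exp_ln)
  moreover have "norm (x t) \<le> ?q t"
    using two_norm_le[of t] norm_ge_zero[of "x t"] by linarith
  ultimately show ?thesis
    by (simp add: power2_norm_eq_inner)
qed

section \<open>High-gain stabilization of an integrator chain\<close>

definition cascade_coeff :: "nat \<Rightarrow> nat \<Rightarrow> real" where
  "cascade_coeff i j = real (i choose j) * 2 ^ (i - j)"

text \<open>The operator \<open>(d/dt + 2)\<^sup>i\<close> applied to \<open>w\<^sub>0\<close>, where \<open>w\<^sub>j\<close> stands for the \<open>j\<close>-th derivative
  of \<open>w\<^sub>0\<close>.\<close>

definition cascade :: "nat \<Rightarrow> (nat \<Rightarrow> real) \<Rightarrow> real" where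
  "cascade i w = (\<Sum>j\<le>i. cascade_coeff i j * w j)"

lemma cascade_coeff_nonneg: "0 \<le> cascade_coeff i j"
  by (simp add: cascade_coeff_def)

lemma cascade_coeff_self: "cascade_coeff i i = 1"
  by (simp add: cascade_coeff_def)

lemma cascade_coeff_Suc_Suc:
  "cascade_coeff (Suc i) (Suc j) = cascade_coeff i j + 2 * cascade_coeff i (Suc j)"
proof (cases "Suc j \<le> i")
  case True
  then have "(2::real) ^ (i - j) = 2 * 2 ^ (i - Suc j)"
    by (metis Suc_diff_Suc Suc_le_lessD power_Suc)
  then show ?thesis by (simp add: cascade_coeff_def algebra_simps)
next
  case False
  then show ?thesis by (simp add: cascade_coeff_def)
qed

text \<open>The factorization \<open>(d/dt + 2)\<^sup>i\<^sup>+\<^sup>1 = (d/dt + 2)\<^sup>i d/dt + 2 (d/dt + 2)\<^sup>i\<close>, from Pascal's rule.\<close>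

lemma cascade_Suc: "cascade (Suc i) w = cascade i (\<lambda>j. w (Suc j)) + 2 * cascade i w"
proof -
  have "cascade (Suc i) w = 2 * cascade_coeff i 0 * w 0
      + (\<Sum>j\<le>i. (cascade_coeff i j + 2 * cascade_coeff i (Suc j)) * w (Suc j))"
    unfolding cascade_def sum.atMost_Suc_shift cascade_coeff_Suc_Suc by (simp add: cascade_coeff_def)
  also have "\<dots> = cascade i (\<lambda>j. w (Suc j)) + 2 * (cascade_coeff i 0 * w 0 + (\<Sum>j\<le>i. cascade_coeff i (Suc j) * w (Suc j)))"
    by (simp add: cascade_def distrib_right sum.distrib sum_distrib_left mult.assoc)
  also have "cascade_coeff i 0 * w 0 + (\<Sum>j\<le>i. cascade_coeff i (Suc j) * w (Suc j))
      = (\<Sum>j\<le>Suc i. cascade_coeff i j * w j)"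
    by (rule sum.atMost_Suc_shift[symmetric])
  also have "\<dots> = cascade i w"
    by (simp add: cascade_def cascade_coeff_def)
  finally show ?thesis .
qed

text \<open>Shifting the chain by one, \<open>w\<^sub>j\<^sub>+\<^sub>1\<close> in place of \<open>w\<^sub>j\<close>, costs a factor three by the recursion for
  the cascade, so the cascade variables control the chain variables.\<close>

lemma abs_le_cascade_bound:
  assumes "\<And>j. j \<le> i \<Longrightarrow> \<bar>cascade j w\<bar> \<le> N"
  shows "\<bar>w i\<bar> \<le> 3 ^ i * N"
  using assms
proof (induction i arbitrary: w N)
  case 0
  then show ?case using 0[of 0] by (simp add: cascade_def cascade_coeff_def)
next
  case (Suc i)
  have "\<bar>cascade j (\<lambda>j. w (Suc j))\<bar> \<le> 3 * N" if "j \<le> i" for j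
    using Suc.prems[of j] Suc.prems[of "Suc j"] that cascade_Suc[of j w] by simp
  from Suc.IH[OF this] show ?case by simp
qed

lemma chain_l1_le_cascade_l2:
  "(\<Sum>j\<le>n. \<bar>w j\<bar>) \<le> real (Suc n) * 3 ^ n * sqrt (\<Sum>i\<le>n. (cascade i w)\<^sup>2)"
proof -
  let ?N = "sqrt (\<Sum>i\<le>n. (cascade i w)\<^sup>2)"
  have "\<bar>w j\<bar> \<le> 3 ^ n * ?N" if "j \<le> n" for j
  proof -
    have "\<bar>cascade i w\<bar> \<le> ?N" if "i \<le> j" for i
      using that \<open>j \<le> n\<close> by (intro real_le_rsqrt) (auto intro!: member_le_sum)
    then have "\<bar>w j\<bar> \<le> 3 ^ j * ?N"
      by (rule abs_le_cascade_bound)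
    also have "\<dots> \<le> 3 ^ n * ?N"
      using that by (intro mult_right_mono power_increasing) (auto intro: sum_nonneg)
    finally show ?thesis .
  qed
  then have "(\<Sum>j\<le>n. \<bar>w j\<bar>) \<le> of_nat (card {..n}) * (3 ^ n * ?N)"
    by (intro sum_bounded_above) auto
  then show ?thesis by (simp add: mult.assoc)
qed

text \<open>If the last equation of the chain differs from \<open>w\<^sub>n' = - \<gamma> \<kappa> s\<^sub>n\<close> by at most \<open>M \<Sum> \<bar>w\<^sub>j\<bar>\<close>, then the
  derivative of \<open>s\<^sub>n\<close> differs from \<open>- \<gamma> \<kappa> s\<^sub>n\<close> by at most this constant times the Euclidean norm of
  \<open>(s\<^sub>0, \<dots>, s\<^sub>n)\<close>.\<close>

definition high_gain_const :: "nat \<Rightarrow> real \<Rightarrow> real" where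
  "high_gain_const n M = (M + (\<Sum>j\<le>n. cascade_coeff n j)) * (real (Suc n) * 3 ^ n)"

text \<open>The cascade variables \<open>s\<^sub>i\<close> satisfy \<open>s\<^sub>i' = s\<^sub>i\<^sub>+\<^sub>1 - 2 s\<^sub>i\<close> for \<open>i < n\<close>, which is dissipative up to
  \<open>s\<^sub>n\<close>. The feedback acts on \<open>s\<^sub>n\<close> alone, and a large gain dominates every term of size
  \<open>O(\<bar>s\<^sub>n\<bar> \<bar>s\<bar>)\<close> in the derivative of \<open>\<bar>s\<bar>\<^sup>2\<close>.\<close>

lemma high_gain_decay:
  fixes w :: "real \<Rightarrow> nat \<Rightarrow> real" and v \<gamma> :: "real \<Rightarrow> real"
  assumes chain: "\<And>j t. j < n \<Longrightarrow> t \<in> {0..T} \<Longrightarrow>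
      ((\<lambda>t. w t j) has_real_derivative w t (Suc j)) (at t within {0..T})"
    and last: "\<And>t. t \<in> {0..T} \<Longrightarrow> ((\<lambda>t. w t n) has_real_derivative v t) (at t within {0..T})"
    and v: "\<And>t. t \<in> {0..T} \<Longrightarrow> \<bar>v t + \<gamma> t * \<kappa> * cascade n (w t)\<bar> \<le> M * (\<Sum>j\<le>n. \<bar>w t j\<bar>)"
    and \<gamma>: "\<And>t. t \<in> {0..T} \<Longrightarrow> b \<le> \<gamma> t"
    and pos: "0 \<le> M" "0 \<le> \<kappa>"
    and \<kappa>: "3 + (high_gain_const n M)\<^sup>2 \<le> 2 * b * \<kappa>"
    and t: "t \<in> {0..T}"
  shows "(\<Sum>i\<le>n. (cascade i (w t))\<^sup>2) \<le> (\<Sum>i\<le>n. (cascade i (w 0))\<^sup>2) * exp (- t)"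
proof -
  let ?V = "\<lambda>t. \<Sum>i\<le>n. (cascade i (w t))\<^sup>2"
  let ?s = "\<lambda>t i. cascade i (w t)"
  define d where "d t i = (if i < n then ?s t (Suc i) - 2 * ?s t i
      else v t + (\<Sum>j<n. cascade_coeff n j * w t (Suc j)))" for t i
  have ds: "((\<lambda>t. ?s t i) has_real_derivative d t i) (at t within {0..T})"
    if i: "i \<le> n" and t: "t \<in> {0..T}" for i t
  proof (cases "i < n")
    case True
    then have "((\<lambda>t. ?s t i) has_real_derivative (\<Sum>j\<le>i. cascade_coeff i j * w t (Suc j))) (at t within {0..T})"
      unfolding cascade_def using t by (intro DERIV_sum DERIV_cmult chain) auto
    then show ?thesis
      using True cascade_Suc[of i "w t"] by (simp add: d_def cascade_def)
  next
    case False
    then have "i = n" using i by simp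
    have "((\<lambda>t. (\<Sum>j<n. cascade_coeff n j * w t j) + w t n) has_real_derivative
        (\<Sum>j<n. cascade_coeff n j * w t (Suc j)) + v t) (at t within {0..T})"
      using t by (intro DERIV_add DERIV_sum DERIV_cmult chain last) auto
    then show ?thesis
      by (simp add: \<open>i = n\<close> d_def cascade_def lessThan_Suc_atMost[symmetric] cascade_coeff_self add.commute)
  qed
  have "?V t \<le> ?V 0 * exp (- 1 * t)"
  proof (rule differential_inequality[OF _ _ t])
    fix t assume t: "t \<in> {0..T}"
    have "((\<lambda>t. (?s t i)\<^sup>2) has_real_derivative 2 * ?s t i * d t i) (at t within {0..T})" if "i \<le> n" for i
      using ds[OF that t] by (auto intro!: derivative_eq_intros)
    then show "(?V has_real_derivative (\<Sum>i\<le>n. 2 * ?s t i * d t i)) (at t within {0..T})"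
      by (intro DERIV_sum) auto
    let ?C = "\<Sum>j\<le>n. cascade_coeff n j" and ?B = "high_gain_const n M" and ?W = "\<Sum>j\<le>n. \<bar>w t j\<bar>"
    have "\<bar>\<Sum>j<n. cascade_coeff n j * w t (Suc j)\<bar> \<le> (\<Sum>j<n. cascade_coeff n j * \<bar>w t (Suc j)\<bar>)"
      by (rule order_trans[OF sum_abs]) (simp add: abs_mult cascade_coeff_nonneg)
    also have "\<dots> \<le> (\<Sum>j<n. cascade_coeff n j * ?W)"
      by (intro sum_mono mult_left_mono cascade_coeff_nonneg) (auto intro!: member_le_sum[of _ _ "\<lambda>j. \<bar>w t j\<bar>"])
    also have "\<dots> \<le> ?C * ?W"
      unfolding sum_distrib_right[symmetric]
      by (intro mult_right_mono sum_mono2 sum_nonneg) (auto simp: cascade_coeff_nonneg)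
    finally have "\<bar>d t n + \<gamma> t * \<kappa> * ?s t n\<bar> \<le> (M + ?C) * ?W"
      using v[OF t] by (simp add: d_def distrib_right)
    also have "\<dots> \<le> (M + ?C) * (real (Suc n) * 3 ^ n * sqrt (?V t))"
      using chain_l1_le_cascade_l2[of "w t" n] pos
      by (intro mult_left_mono add_nonneg_nonneg sum_nonneg) (auto simp: cascade_coeff_nonneg)
    finally have dn: "\<bar>d t n + \<gamma> t * \<kappa> * ?s t n\<bar> \<le> ?B * sqrt (?V t)"
      by (simp add: high_gain_const_def mult.assoc)
    let ?e = "d t n + \<gamma> t * \<kappa> * ?s t n"
    have "?s t n * ?e \<le> \<bar>?s t n\<bar> * \<bar>?e\<bar>"
      unfolding abs_mult[symmetric] by (rule abs_ge_self)
    also have "\<dots> \<le> \<bar>?s t n\<bar> * (?B * sqrt (?V t))"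
      by (rule mult_left_mono[OF dn abs_ge_zero])
    finally have "2 * (?s t n * ?e) \<le> ?B\<^sup>2 * (?s t n)\<^sup>2 + ?V t"
      using sum_squares_bound[of "?B * \<bar>?s t n\<bar>" "sqrt (?V t)"]
      by (simp add: power_mult_distrib sum_nonneg mult_ac)
    moreover have "(3 + ?B\<^sup>2) * (?s t n)\<^sup>2 \<le> 2 * (\<gamma> t * \<kappa>) * (?s t n)\<^sup>2"
      using \<kappa> mult_right_mono[OF \<gamma>[OF t] pos(2)] by (intro mult_right_mono) auto
    moreover have "2 * ?s t n * d t n = 2 * (?s t n * ?e) - 2 * (\<gamma> t * \<kappa>) * (?s t n)\<^sup>2"
      by (simp add: algebra_simps power2_eq_square)
    ultimately have top: "2 * ?s t n * d t n \<le> ?V t - 3 * (?s t n)\<^sup>2"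
      by (simp add: distrib_right)
    have "(\<Sum>i<n. 2 * ?s t i * d t i) \<le> (\<Sum>i<n. (?s t (Suc i))\<^sup>2 - 3 * (?s t i)\<^sup>2)"
    proof (intro sum_mono)
      fix i assume "i \<in> {..<n}"
      then show "2 * ?s t i * d t i \<le> (?s t (Suc i))\<^sup>2 - 3 * (?s t i)\<^sup>2"
        using sum_squares_bound[of "?s t i" "?s t (Suc i)"]
        by (simp add: d_def algebra_simps power2_eq_square)
    qed
    also have "\<dots> = ((\<Sum>i<Suc n. (?s t i)\<^sup>2) - (?s t 0)\<^sup>2) - 3 * (\<Sum>i<n. (?s t i)\<^sup>2)"
      by (simp add: sum_subtractf sum_distrib_left sum.lessThan_Suc_shift del: sum.lessThan_Suc)
    finally have low: "(\<Sum>i<n. 2 * ?s t i * d t i) \<le> ?V t - 3 * (\<Sum>i<n. (?s t i)\<^sup>2)"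
      using zero_le_power2[of "?s t 0"] unfolding lessThan_Suc_atMost by linarith
    have "(\<Sum>i\<le>n. 2 * ?s t i * d t i) = (\<Sum>i<n. 2 * ?s t i * d t i) + 2 * ?s t n * d t n"
      by (simp add: lessThan_Suc_atMost[symmetric])
    moreover have "?V t = (\<Sum>i<n. (?s t i)\<^sup>2) + (?s t n)\<^sup>2"
      by (simp add: lessThan_Suc_atMost[symmetric])
    (* low and top together leave 2 V - 3 V *)
    ultimately show "(\<Sum>i\<le>n. 2 * ?s t i * d t i) \<le> - 1 * ?V t"
      using low top by linarith
  qed
  then show ?thesis by simp
qed

section \<open>The closed loop\<close>

definition feedback :: "real \<Rightarrow> 'n::{finite,linorder} vfield \<Rightarrow> 'n outmap \<Rightarrow> 'n gains \<Rightarrow>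
    real \<times> 'n state \<Rightarrow> real" where
  "feedback ystar f h k p = fst k * fst p - snd k \<bullet> (Phi f h (snd p) - zstar ystar)"

text \<open>The integral of the error is adjoined to the state as an extra coordinate, in front.\<close>

definition closed_loop_field :: "real \<Rightarrow> 'n::{finite,linorder} vfield \<Rightarrow> 'n vfield \<Rightarrow> 'n outmap \<Rightarrow>
    'n gains \<Rightarrow> real \<times> 'n state \<Rightarrow> real \<times> 'n state" where
  "closed_loop_field ystar f g h k p =
     (ystar - h (snd p), f (snd p) + feedback ystar f h k p *\<^sub>R g (snd p))"

lemma lipschitz_on_balls_closed_loop_field:
  assumes "smooth f" "smooth g" "smooth h"
  shows "lipschitz_on_balls (closed_loop_field ystar f g h k)"
  unfolding closed_loop_field_def[abs_def] feedback_def Phi_def inner_vec_def vector_minus_component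
    vec_lambda_beta inner_real_def
  by (intro smooth_lipschitz_on_balls smooth_Pair smooth_diff smooth_add smooth_scaleR smooth_mult
      smooth_sum smooth_const smooth_fst smooth_compose_snd smooth_lie_power assms)

locale relative_degree_system =
  fixes f g :: "'n::{finite,linorder} vfield" and h :: "'n outmap"
  assumes smooth_f: "smooth f" and smooth_g: "smooth g" and smooth_h: "smooth h"
    and rel_degree: "uniform_relative_degree f g h"
begin

abbreviation out_lie :: "nat \<Rightarrow> 'n outmap" where
  "out_lie j \<equiv> (lie f ^^ j) h"

lemma lie_g_zero: "j + 1 < CARD('n) \<Longrightarrow> lie g (out_lie j) x = 0"
  using rel_degree by (simp add: uniform_relative_degree_def)

lemma smooth_out_lie: "smooth (out_lie j)"
  by (intro smooth_lie_power smooth_f smooth_h)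

lemma out_lie_dir_deriv:
  "dir_deriv (out_lie j) (f y + u *\<^sub>R g y) y = out_lie (Suc j) y + u * lie g (out_lie j) y"
proof -
  have lin: "linear (frechet_derivative (out_lie j) (at y))"
    using linear_frechet_derivative smooth_differentiable[OF smooth_out_lie] by blast
  show ?thesis
    by (simp add: linear_scale[OF lin] linear_add[OF lin] lie_eq_dir_deriv[OF smooth_out_lie])
qed

lemma out_lie_has_derivative:
  assumes "(x has_vector_derivative f (x t) + u *\<^sub>R g (x t)) (at t within A)"
  shows "((\<lambda>t. out_lie j (x t)) has_real_derivative
    out_lie (Suc j) (x t) + u * lie g (out_lie j) (x t)) (at t within A)"
proof -
  have lin: "linear (frechet_derivative (out_lie j) (at (x t)))"
    using linear_frechet_derivative smooth_differentiable[OF smooth_out_lie] by blast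
  have "((\<lambda>t. out_lie j (x t)) has_derivative
      (\<lambda>d. dir_deriv (out_lie j) (d *\<^sub>R (f (x t) + u *\<^sub>R g (x t))) (x t))) (at t within A)"
    using assms smooth_has_derivative[OF smooth_out_lie] unfolding has_vector_derivative_def
    by (rule has_derivative_compose)
  then show ?thesis
    unfolding linear_scale[OF lin] out_lie_dir_deriv has_field_derivative_def
    by (rule has_derivative_eq_rhs) (simp add: mult.commute fun_eq_iff)
qed

lemma out_lie_chain:
  assumes "(x has_vector_derivative f (x t) + u *\<^sub>R g (x t)) (at t within A)" "j + 1 < CARD('n)"
  shows "((\<lambda>t. out_lie j (x t)) has_real_derivative out_lie (Suc j) (x t)) (at t within A)"
  using out_lie_has_derivative[OF assms(1), of j] lie_g_zero[OF assms(2)] by simp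

lemma out_lie_chain_end:
  assumes "(x has_vector_derivative f (x t) + u *\<^sub>R g (x t)) (at t within A)"
  shows "((\<lambda>t. out_lie (CARD('n) - 1) (x t)) has_real_derivative
    F_fun f h (x t) + u * G_fun f g h (x t)) (at t within A)"
proof -
  have "Suc (CARD('n) - 1) = CARD('n)"
    by simp
  then show ?thesis
    using out_lie_has_derivative[OF assms, of "CARD('n) - 1"]
    by (simp only: F_fun_def G_fun_def)
qed

text \<open>The error derivatives used by the controller are those of the output along the chain of
  Lie derivatives, whatever the input: the input first enters at order \<open>n\<close>.\<close>

lemma error_derivatives:
  fixes u :: "real \<Rightarrow> real"
  assumes x: "\<And>t. 0 \<le> t \<Longrightarrow> (x has_vector_derivative f (x t) + u t *\<^sub>R g (x t)) (at t within {0..})"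
  shows "j < CARD('n) \<Longrightarrow> 0 \<le> t \<Longrightarrow>
      (tderiv ^^ j) (reg_error ystar h x) t = (if j = 0 then ystar else 0) - out_lie j (x t)"
    and "j + 1 < CARD('n) \<Longrightarrow> 0 \<le> t \<Longrightarrow>
      (tderiv ^^ j) (reg_error ystar h x) differentiable (at t within {0..})"
proof -
  have step: "((tderiv ^^ j) (reg_error ystar h x) has_vector_derivative - out_lie (Suc j) (x t))
      (at t within {0..})"
    if j: "j + 1 < CARD('n)" and t: "0 \<le> t" and
      eq: "\<And>t. 0 \<le> t \<Longrightarrow> (tderiv ^^ j) (reg_error ystar h x) t = (if j = 0 then ystar else 0) - out_lie j (x t)"
    for j t
  proof -
    have "((\<lambda>t. (if j = 0 then ystar else 0) - out_lie j (x t)) has_real_derivative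
        0 - out_lie (Suc j) (x t)) (at t within {0..})"
      by (intro DERIV_diff DERIV_const out_lie_chain[OF x[OF t] j])
    then show ?thesis
      unfolding has_real_derivative_iff_has_vector_derivative diff_0
      by (rule has_vector_derivative_transform[rotated 2]) (use t eq in auto)
  qed
  have eq: "j < CARD('n) \<Longrightarrow> 0 \<le> t \<Longrightarrow>
      (tderiv ^^ j) (reg_error ystar h x) t = (if j = 0 then ystar else 0) - out_lie j (x t)" for j t
  proof (induction j arbitrary: t)
    case 0
    then show ?case by (simp add: reg_error_def)
  next
    case (Suc j)
    have "((tderiv ^^ j) (reg_error ystar h x) has_vector_derivative - out_lie (Suc j) (x t))
      (at t within {0..})"
      using Suc by (intro step) auto
    moreover have "at t within {0..} \<noteq> bot"
      using Suc.prems at_within_Ici_at_right[of t] by (cases "t = 0")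
        (auto simp: at_within_interior[of t "{0..}"])
    ultimately have "tderiv ((tderiv ^^ j) (reg_error ystar h x)) t = - out_lie (Suc j) (x t)"
      unfolding tderiv_def[of "(tderiv ^^ j) (reg_error ystar h x)"] by (intro vector_derivative_within)
    then show ?case by simp
  qed
  show "j < CARD('n) \<Longrightarrow> 0 \<le> t \<Longrightarrow>
      (tderiv ^^ j) (reg_error ystar h x) t = (if j = 0 then ystar else 0) - out_lie j (x t)"
    by (rule eq)
  show "j + 1 < CARD('n) \<Longrightarrow> 0 \<le> t \<Longrightarrow>
      (tderiv ^^ j) (reg_error ystar h x) differentiable (at t within {0..})"
    using step[OF _ _ eq] by (auto intro: differentiableI_vector)
qed

lemma extended_pid_eq_feedback:
  fixes u :: "real \<Rightarrow> real"
  assumes "\<And>t. 0 \<le> t \<Longrightarrow> (x has_vector_derivative f (x t) + u t *\<^sub>R g (x t)) (at t within {0..})"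
    and "0 \<le> t"
  shows "extended_pid k (reg_error ystar h x) t
    = feedback ystar f h k (integral {0..t} (reg_error ystar h x), x t)"
proof -
  have "(tderiv ^^ pos i) (reg_error ystar h x) t = - (Phi f h (x t) - zstar ystar) $ i" for i :: 'n
    using error_derivatives(1)[OF assms(1) pos_less assms(2), where ystar = ystar]
    by (simp add: Phi_def zstar_def)
  then show ?thesis
    by (simp add: extended_pid_def feedback_def inner_vec_def sum_negf[symmetric] right_diff_distrib
        del: sum_subtractf)
qed

text \<open>Along every closed-loop solution the controller is the static feedback of the extended state.\<close>

lemma closed_loop_solution_imp_field:
  assumes sol: "closed_loop_solution ystar f g h k \<xi> x"
  defines "p \<equiv> \<lambda>t. (integral {0..t} (reg_error ystar h x), x t)"
  shows "p 0 = (0, \<xi>)" and "solution_on (closed_loop_field ystar f g h k) T p"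
proof -
  have x: "(x has_vector_derivative f (x t) + extended_pid k (reg_error ystar h x) t *\<^sub>R g (x t))
      (at t within {0..})" if "0 \<le> t" for t
    using sol that by (simp add: closed_loop_solution_def)
  show "p 0 = (0, \<xi>)"
    using sol by (simp add: p_def closed_loop_solution_def)
  have "continuous_on {0..} x"
    using x by (intro continuous_on_vector_derivative) auto
  then have cont: "continuous_on {0..T} (reg_error ystar h x)"
    unfolding reg_error_def[abs_def]
    by (intro continuous_intros continuous_on_compose2[OF smooth_continuous[OF smooth_h, of UNIV]])
      (auto intro: continuous_on_subset)
  show "solution_on (closed_loop_field ystar f g h k) T p"
    unfolding solution_on_def
  proof
    fix t assume t: "t \<in> {0..T}"
    then have "0 \<le> t" by simp
    have "(p has_vector_derivative (reg_error ystar h x t,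
        f (x t) + extended_pid k (reg_error ystar h x) t *\<^sub>R g (x t))) (at t within {0..T})"
      unfolding p_def
      by (intro has_vector_derivative_Pair integral_has_vector_derivative cont t
          has_vector_derivative_within_subset[OF x[OF \<open>0 \<le> t\<close>]]) auto
    then show "(p has_vector_derivative closed_loop_field ystar f g h k (p t)) (at t within {0..T})"
      by (simp add: closed_loop_field_def p_def extended_pid_eq_feedback[OF x \<open>0 \<le> t\<close>] reg_error_def)
  qed
qed

lemma field_imp_closed_loop_solution:
  assumes p0: "p 0 = (0, \<xi>)"
    and p: "\<And>t. 0 \<le> t \<Longrightarrow> (p has_vector_derivative closed_loop_field ystar f g h k (p t)) (at t within {0..})"
  shows "closed_loop_solution ystar f g h k \<xi> (\<lambda>t. snd (p t))"
proof -
  let ?x = "\<lambda>t. snd (p t)" and ?u = "\<lambda>t. feedback ystar f h k (p t)"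
  have x: "(?x has_vector_derivative f (?x t) + ?u t *\<^sub>R g (?x t)) (at t within {0..})"
    and y: "((\<lambda>t. fst (p t)) has_vector_derivative reg_error ystar h ?x t) (at t within {0..})"
    if "0 \<le> t" for t
    using bounded_linear.has_vector_derivative[OF bounded_linear_snd p[OF that]]
      bounded_linear.has_vector_derivative[OF bounded_linear_fst p[OF that]]
    by (simp_all add: closed_loop_field_def reg_error_def)
  have "integral {0..t} (reg_error ystar h ?x) = fst (p t)" if t: "0 \<le> t" for t
  proof (rule integral_unique)
    have "(reg_error ystar h ?x has_integral (fst (p t) - fst (p 0))) {0..t}"
      using t by (intro fundamental_theorem_of_calculus)
        (auto intro: has_vector_derivative_within_subset[OF y])
    then show "(reg_error ystar h ?x has_integral fst (p t)) {0..t}"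
      by (simp add: p0)
  qed
  then have "extended_pid k (reg_error ystar h ?x) t = ?u t" if "0 \<le> t" for t
    using extended_pid_eq_feedback[OF x that, where k = k and ystar = ystar] that by simp
  then show ?thesis
    unfolding closed_loop_solution_def
    using x error_derivatives(2)[OF x] p0 by auto
qed

end

lemma norm_fst_snd_le: "norm (fst p) \<le> norm p" "norm (snd p) \<le> norm p"
  by (metis norm_fst_le prod.collapse) (metis norm_snd_le prod.collapse)

section \<open>The gains\<close>

definition gain_direction :: "'n::{finite,linorder} gains" where
  "gain_direction = (cascade_coeff CARD('n) 0, \<chi> i. cascade_coeff CARD('n) (Suc (pos i)))"

text \<open>A bound, relative to \<open>\<Sum> \<bar>w\<^sub>j\<bar>\<close>, for everything in the last equation of the chain apart from the
  feedback along the axis of the tube: the drift contributes \<open>L\<close>, the variation of \<open>G\<close> times the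
  equilibrium input contributes \<open>L \<tau> / b_lo\<close>, and the deviation of the gains from the axis
  contributes \<open>b_up\<close>. The first argument only carries the dimension of the state space.\<close>

definition disturbance_const ::
  "'n::{finite,linorder} itself \<Rightarrow> real \<Rightarrow> real \<Rightarrow> real \<Rightarrow> real \<Rightarrow> (real \<Rightarrow> real) \<Rightarrow> real" where
  "disturbance_const N ystar b_lo b_up L \<tau> =
     L * (1 + \<tau> (norm (zstar ystar :: 'n state)) / b_lo) + b_up"

text \<open>The second entry is the gain that \<open>high_gain_decay\<close> asks for. The first keeps the integral gain
  positive throughout the tube, so that the integral term can supply the equilibrium input.\<close>

definition min_gain ::
  "'n::{finite,linorder} itself \<Rightarrow> real \<Rightarrow> real \<Rightarrow> real \<Rightarrow> real \<Rightarrow> (real \<Rightarrow> real) \<Rightarrow> real" where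
  "min_gain N ystar b_lo b_up L \<tau> =
     max 1 ((3 + (high_gain_const CARD('n) (disturbance_const N ystar b_lo b_up L \<tau>))\<^sup>2) / (2 * b_lo))"

text \<open>A tube of radius one around a ray. Its thickness makes the set open; the deviation from the
  axis is a bounded perturbation, which the gain along the axis dominates.\<close>

definition gain_set ::
  "real \<Rightarrow> real \<Rightarrow> real \<Rightarrow> real \<Rightarrow> (real \<Rightarrow> real) \<Rightarrow> 'n::{finite,linorder} gains set" where
  "gain_set ystar b_lo b_up L \<tau> =
     (\<Union>\<kappa>\<in>{min_gain TYPE('n) ystar b_lo b_up L \<tau><..}. ball (\<kappa> *\<^sub>R gain_direction) 1)"

lemma open_gain_set: "open (gain_set ystar b_lo b_up L \<tau>)"
  unfolding gain_set_def by auto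

lemma gain_direction_fst: "1 \<le> fst (gain_direction :: 'n::{finite,linorder} gains)"
  by (simp add: gain_direction_def cascade_coeff_def)

lemma unbounded_gain_set: "\<not> bounded (gain_set ystar b_lo b_up L \<tau> :: 'n::{finite,linorder} gains set)"
proof
  let ?\<Omega> = "gain_set ystar b_lo b_up L \<tau> :: 'n gains set"
  let ?d = "gain_direction :: 'n gains"
  assume "bounded ?\<Omega>"
  then obtain B where B: "\<And>k. k \<in> ?\<Omega> \<Longrightarrow> norm k \<le> B"
    by (auto simp: bounded_iff)
  define \<kappa> where "\<kappa> = max 0 (max B (min_gain TYPE('n) ystar b_lo b_up L \<tau>)) + 1"
  have "\<kappa> *\<^sub>R ?d \<in> ?\<Omega>"
    unfolding gain_set_def by (intro UN_I[of \<kappa>]) (auto simp: \<kappa>_def)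
  then have "norm (\<kappa> *\<^sub>R ?d) \<le> B"
    by (rule B)
  moreover have "\<kappa> * 1 \<le> norm (\<kappa> *\<^sub>R ?d)"
  proof -
    have "1 \<le> norm ?d"
      using gain_direction_fst[where 'n = 'n] norm_fst_snd_le(1)[of ?d] by simp
    moreover have "0 \<le> \<kappa>" by (simp add: \<kappa>_def)
    ultimately show ?thesis by (simp add: mult_left_mono[of 1 "norm ?d" \<kappa>, simplified])
  qed
  ultimately show False by (simp add: \<kappa>_def)
qed

section \<open>Exponential decay and global existence\<close>

locale regulated_system = relative_degree_system f g h
  for f g :: "'n::{finite,linorder} vfield" and h :: "'n outmap" +
  fixes ystar b_lo b_up L :: real and \<tau> :: "real \<Rightarrow> real" and k :: "'n gains"
  assumes A: "assumption_A b_lo f g h"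
    and B1: "assumption_B1 ystar b_up L \<tau> f g h"
    and b_lo_pos: "0 < b_lo" and b_up_pos: "0 < b_up" and L_pos: "0 < L"
    and mono_\<tau>: "mono_on {0..} \<tau>" and \<tau>_nonneg: "\<And>s. 0 \<le> s \<Longrightarrow> 0 \<le> \<tau> s"
    and gains: "k \<in> gain_set ystar b_lo b_up L \<tau>"
begin

abbreviation output_error :: "'n state \<Rightarrow> 'n state" where
  "output_error x \<equiv> Phi f h x - zstar ystar"

lemma G_ge: "b_lo \<le> G_fun f g h x"
  using A by (simp add: assumption_A_def)

lemma G_le: "G_fun f g h x \<le> b_up"
  using B1 by (simp add: assumption_B1_def)

lemma H_le: "norm (H_fun f g h x) \<le> \<tau> (norm (Phi f h x))"
  using B1 by (simp add: assumption_B1_def)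

text \<open>Here \<open>c\<close> is the equilibrium value of the integral state. The sign of its deviation is chosen so
  that its derivative is the first component of the output error.\<close>

definition chain_var :: "real \<Rightarrow> real \<times> 'n state \<Rightarrow> nat \<Rightarrow> real" where
  "chain_var c p j = (case j of 0 \<Rightarrow> c - fst p
     | Suc m \<Rightarrow> out_lie m (snd p) - (if m = 0 then ystar else 0))"

lemma chain_var_0: "chain_var c p 0 = c - fst p"
  by (simp add: chain_var_def)

lemma chain_var_Suc_pos: "chain_var c p (Suc (pos i)) = output_error (snd p) $ i"
  by (simp add: chain_var_def Phi_def zstar_def)

lemma output_error_le_chain:
  "norm (output_error (snd p)) \<le> (\<Sum>j<CARD('n). \<bar>chain_var c p (Suc j)\<bar>)"
proof -
  have "norm (output_error (snd p)) \<le> (\<Sum>i\<in>UNIV. \<bar>output_error (snd p) $ i\<bar>)"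
    by (rule norm_le_l1_cart)
  also have "\<dots> = (\<Sum>i\<in>UNIV. \<bar>chain_var c p (Suc (pos (i :: 'n)))\<bar>)"
    by (simp only: chain_var_Suc_pos)
  also have "\<dots> = (\<Sum>j<CARD('n). \<bar>chain_var c p (Suc j)\<bar>)"
    by (rule sum_pos[where q = "\<lambda>j. \<bar>chain_var c p (Suc j)\<bar>"])
  finally show ?thesis .
qed

lemma chain_l1_eq:
  "(\<Sum>j\<le>CARD('n). \<bar>chain_var c p j\<bar>)
    = \<bar>chain_var c p 0\<bar> + (\<Sum>j<CARD('n). \<bar>chain_var c p (Suc j)\<bar>)"
  by (simp add: lessThan_Suc_atMost[symmetric] sum.lessThan_Suc_shift del: sum.lessThan_Suc)

text \<open>Gains along the axis of the tube feed back a multiple of the top cascade variable.\<close>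

lemma chain_var_eq_cascade:
  "fst (gain_direction :: 'n gains) * chain_var c p 0 + snd gain_direction \<bullet> output_error (snd p)
    = cascade CARD('n) (chain_var c p)"
proof -
  have "snd gain_direction \<bullet> output_error (snd p)
      = (\<Sum>i\<in>UNIV. cascade_coeff CARD('n) (Suc (pos i)) * chain_var c p (Suc (pos (i :: 'n))))"
    by (simp add: inner_vec_def gain_direction_def chain_var_Suc_pos)
  also have "\<dots> = (\<Sum>j<CARD('n). cascade_coeff CARD('n) (Suc j) * chain_var c p (Suc j))"
    by (rule sum_pos)
  finally show ?thesis
    by (simp add: gain_direction_def cascade_def lessThan_Suc_atMost[symmetric] sum.lessThan_Suc_shift
        del: sum.lessThan_Suc)
qed

lemma chain_var_deriv:
  assumes p: "(p has_vector_derivative closed_loop_field ystar f g h k (p t)) (at t within A)"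
  shows "j < CARD('n) \<Longrightarrow>
      ((\<lambda>t. chain_var c (p t) j) has_real_derivative chain_var c (p t) (Suc j)) (at t within A)"
    and "((\<lambda>t. chain_var c (p t) CARD('n)) has_real_derivative
      F_fun f h (snd (p t)) + feedback ystar f h k (p t) * G_fun f g h (snd (p t))) (at t within A)"
proof -
  have x: "((\<lambda>t. snd (p t)) has_vector_derivative
      f (snd (p t)) + feedback ystar f h k (p t) *\<^sub>R g (snd (p t))) (at t within A)"
    and y: "((\<lambda>t. fst (p t)) has_real_derivative ystar - h (snd (p t))) (at t within A)"
    using bounded_linear.has_vector_derivative[OF bounded_linear_snd p]
      bounded_linear.has_vector_derivative[OF bounded_linear_fst p]
    by (simp_all add: closed_loop_field_def has_real_derivative_iff_has_vector_derivative)
  show "((\<lambda>t. chain_var c (p t) j) has_real_derivative chain_var c (p t) (Suc j)) (at t within A)"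
    if "j < CARD('n)"
  proof (cases j)
    case 0
    have "((\<lambda>t. c - fst (p t)) has_real_derivative 0 - (ystar - h (snd (p t)))) (at t within A)"
      by (intro DERIV_diff DERIV_const y)
    then show ?thesis by (simp add: 0 chain_var_def)
  next
    case (Suc m)
    have "((\<lambda>t. out_lie m (snd (p t)) - (if m = 0 then ystar else 0)) has_real_derivative
        out_lie (Suc m) (snd (p t)) - 0) (at t within A)"
      using that Suc by (intro DERIV_diff DERIV_const out_lie_chain[OF x]) auto
    then show ?thesis by (simp add: Suc chain_var_def)
  qed
  obtain m where m: "CARD('n) = Suc m"
    by (metis zero_less_card_finite gr0_implies_Suc)
  have "((\<lambda>t. out_lie m (snd (p t)) - (if m = 0 then ystar else 0)) has_real_derivative
      F_fun f h (snd (p t)) + feedback ystar f h k (p t) * G_fun f g h (snd (p t)) - 0) (at t within A)"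
    using out_lie_chain_end[OF x] by (intro DERIV_diff DERIV_const) (simp add: m)
  then show "((\<lambda>t. chain_var c (p t) CARD('n)) has_real_derivative
      F_fun f h (snd (p t)) + feedback ystar f h k (p t) * G_fun f g h (snd (p t))) (at t within A)"
    by (simp add: m chain_var_def)
qed

text \<open>At the equilibrium the input \<open>- F (x\<^sup>*) / G (x\<^sup>*)\<close> is supplied by the integral term, which fixes
  the equilibrium value of the integral state. What remains of the drift is at most
  proportional to the output error by the Lipschitz condition at \<open>x\<^sup>*\<close>.\<close>

lemma closed_loop_decay:
  "\<exists>c. \<forall>p0. \<exists>C\<ge>0. \<forall>T p. solution_on (closed_loop_field ystar f g h k) T p \<longrightarrow> p 0 = p0 \<longrightarrow>
     (\<forall>t\<in>{0..T}. \<bar>c - fst (p t)\<bar> \<le> C * exp (- t / 2) \<and>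
        norm (output_error (snd (p t))) \<le> C * exp (- t / 2))"
proof -
  let ?n = "CARD('n)" and ?M = "disturbance_const TYPE('n) ystar b_lo b_up L \<tau>"
  obtain xs where xs: "Phi f h xs = zstar ystar"
    and lip: "\<And>x. norm (H_fun f g h x - H_fun f g h xs) \<le> L * norm (Phi f h x - Phi f h xs)"
    using B1 unfolding assumption_B1_def by auto
  obtain \<kappa> where \<kappa>: "min_gain TYPE('n) ystar b_lo b_up L \<tau> < \<kappa>"
    and near: "norm (k - \<kappa> *\<^sub>R gain_direction) < 1"
    using gains unfolding gain_set_def by (auto simp: dist_norm norm_minus_commute)
  define d where "d = k - \<kappa> *\<^sub>R gain_direction"
  have k: "k = \<kappa> *\<^sub>R gain_direction + d" by (simp add: d_def)
  have d1: "\<bar>fst d\<bar> \<le> 1" "norm (snd d) \<le> 1"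
    using near norm_fst_snd_le[of d] unfolding d_def[symmetric] by auto
  have \<kappa>1: "1 < \<kappa>"
    using \<kappa> by (simp add: min_gain_def)
  have "fst k \<noteq> 0"
  proof -
    have "1 < \<kappa> * fst (gain_direction :: 'n gains)"
      using \<kappa>1 gain_direction_fst[where 'n = 'n] by (metis less_1_mult less_eq_real_def mult.right_neutral)
    then show ?thesis using d1(1) by (simp add: k)
  qed
  define us where "us = - F_fun f h xs / G_fun f g h xs"
  define c where "c = us / fst k"
  have Gs: "0 < G_fun f g h xs"
    using G_ge[of xs] b_lo_pos by linarith
  have "\<bar>F_fun f h xs\<bar> \<le> \<tau> (norm (zstar ystar :: 'n state))"
    using H_le[of xs] norm_fst_snd_le(1)[of "H_fun f g h xs"] xs by (simp add: H_fun_def)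
  then have us: "\<bar>us\<bar> \<le> \<tau> (norm (zstar ystar :: 'n state)) / b_lo"
    using G_ge[of xs] b_lo_pos Gs \<tau>_nonneg by (simp add: us_def frac_le)
  let ?w = "\<lambda>p. chain_var c p" and ?G = "\<lambda>p. G_fun f g h (snd p)"
  have u_eq: "feedback ystar f h k p = us - \<kappa> * cascade ?n (?w p)
      - (fst d * ?w p 0 + snd d \<bullet> output_error (snd p))" for p
  proof -
    have "fst k * fst p = us - fst k * ?w p 0"
      using \<open>fst k \<noteq> 0\<close> by (simp add: chain_var_0 c_def right_diff_distrib)
    then show ?thesis
      unfolding chain_var_eq_cascade[symmetric]
      by (simp add: feedback_def k inner_add_left distrib_left distrib_right)
  qed
  have pert: "\<bar>F_fun f h (snd p) + feedback ystar f h k p * ?G p + ?G p * \<kappa> * cascade ?n (?w p)\<bar>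
      \<le> ?M * (\<Sum>j\<le>?n. \<bar>?w p j\<bar>)" for p
  proof -
    let ?W = "\<Sum>j\<le>?n. \<bar>?w p j\<bar>" and ?x = "snd p"
    let ?e = "fst d * ?w p 0 + snd d \<bullet> output_error ?x"
    have Fs: "F_fun f h xs = - us * G_fun f g h xs"
      using Gs by (simp add: us_def)
    have eW: "norm (output_error ?x) \<le> ?W"
      using output_error_le_chain[of p c] by (simp add: chain_l1_eq)
    have Hle: "norm (H_fun f g h ?x - H_fun f g h xs) \<le> L * ?W"
      using lip[of ?x] mult_left_mono[OF eW, of L] L_pos unfolding xs by linarith
    have FG: "\<bar>F_fun f h ?x - F_fun f h xs\<bar> \<le> L * ?W" "\<bar>G_fun f g h ?x - G_fun f g h xs\<bar> \<le> L * ?W"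
      using Hle norm_fst_snd_le[of "H_fun f g h ?x - H_fun f g h xs"] by (auto simp: H_fun_def)
    have "\<bar>?e\<bar> \<le> ?W"
    proof -
      have "\<bar>fst d * ?w p 0\<bar> \<le> 1 * \<bar>?w p 0\<bar>"
        unfolding abs_mult by (intro mult_right_mono d1) auto
      moreover have "\<bar>snd d \<bullet> output_error ?x\<bar> \<le> norm (snd d) * norm (output_error ?x)"
        by (rule Cauchy_Schwarz_ineq2)
      moreover have "\<dots> \<le> 1 * norm (output_error ?x)"
        by (intro mult_right_mono d1) auto
      moreover have "norm (output_error ?x) \<le> (\<Sum>j<?n. \<bar>?w p (Suc j)\<bar>)"
        by (rule output_error_le_chain)
      ultimately show ?thesis
        unfolding chain_l1_eq using abs_triangle_ineq[of "fst d * ?w p 0" "snd d \<bullet> output_error ?x"]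
        by linarith
    qed
    then have "\<bar>?G p * ?e\<bar> \<le> b_up * ?W"
      unfolding abs_mult using G_ge[of ?x] G_le[of ?x] b_lo_pos by (intro mult_mono) auto
    moreover have "\<bar>(G_fun f g h ?x - G_fun f g h xs) * us\<bar> \<le> (L * ?W) * (\<tau> (norm (zstar ystar :: 'n state)) / b_lo)"
      unfolding abs_mult using FG us L_pos by (intro mult_mono mult_nonneg_nonneg) (auto intro: sum_nonneg)
    moreover have "F_fun f h ?x + feedback ystar f h k p * ?G p + ?G p * \<kappa> * cascade ?n (?w p)
        = (F_fun f h ?x - F_fun f h xs) + (G_fun f g h ?x - G_fun f g h xs) * us - ?G p * ?e"
      unfolding u_eq Fs by (simp add: algebra_simps)
    moreover have "?M * ?W = L * ?W + (L * ?W) * (\<tau> (norm (zstar ystar :: 'n state)) / b_lo) + b_up * ?W"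
      by (simp add: disturbance_const_def algebra_simps)
    ultimately show ?thesis
      using FG(1) by linarith
  qed
  have M: "0 \<le> ?M"
    unfolding disturbance_const_def using L_pos b_up_pos b_lo_pos \<tau>_nonneg by simp
  have \<kappa>2: "3 + (high_gain_const ?n ?M)\<^sup>2 \<le> 2 * b_lo * \<kappa>"
    using \<kappa> b_lo_pos by (simp add: min_gain_def pos_divide_less_eq mult.commute)
  show ?thesis
  proof (rule exI[of _ c], rule allI)
    fix p0 :: "real \<times> 'n state"
    define V where "V p = (\<Sum>i\<le>?n. (cascade i (?w p))\<^sup>2)" for p
    let ?C = "real (Suc ?n) * 3 ^ ?n * sqrt (V p0)"
    have V_nonneg: "0 \<le> V p" for p by (simp add: V_def sum_nonneg)
    have "\<bar>c - fst (p t)\<bar> \<le> ?C * exp (- t / 2) \<and> norm (output_error (snd (p t))) \<le> ?C * exp (- t / 2)"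
      if sol: "solution_on (closed_loop_field ystar f g h k) T p" and p0: "p 0 = p0" and t: "t \<in> {0..T}"
      for T p t
    proof -
      have deriv: "(p has_vector_derivative closed_loop_field ystar f g h k (p t)) (at t within {0..T})"
        if "t \<in> {0..T}" for t
        using sol that by (simp add: solution_on_def)
      have "V (p t) \<le> V (p 0) * exp (- t)"
        unfolding V_def
      proof (rule high_gain_decay[where \<gamma> = "\<lambda>t. ?G (p t)" and M = ?M and b = b_lo and \<kappa> = \<kappa>,
            OF _ _ _ _ M _ \<kappa>2 t])
        show "((\<lambda>t. ?w (p t) j) has_real_derivative ?w (p t) (Suc j)) (at t within {0..T})"
          if "j < ?n" "t \<in> {0..T}" for j t
          using chain_var_deriv(1)[OF deriv] that by blast
        show "((\<lambda>t. ?w (p t) ?n) has_real_derivative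
            F_fun f h (snd (p t)) + feedback ystar f h k (p t) * ?G (p t)) (at t within {0..T})"
          if "t \<in> {0..T}" for t
          using chain_var_deriv(2)[OF deriv[OF that]] .
        show "\<bar>F_fun f h (snd (p t)) + feedback ystar f h k (p t) * ?G (p t)
            + ?G (p t) * \<kappa> * cascade ?n (?w (p t))\<bar> \<le> ?M * (\<Sum>j\<le>?n. \<bar>?w (p t) j\<bar>)" for t
          by (rule pert)
        show "b_lo \<le> ?G (p t)" for t by (rule G_ge)
        show "0 \<le> \<kappa>" using \<kappa>1 by simp
      qed
      then have "sqrt (V (p t)) \<le> sqrt (V p0 * exp (- t))"
        by (simp add: p0)
      also have "\<dots> = sqrt (V p0) * exp (- t / 2)"
      proof -
        have "exp (- t) = (exp (- t / 2))\<^sup>2"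
          by (simp add: power2_eq_square flip: exp_add)
        then show ?thesis by (simp add: real_sqrt_mult)
      qed
      finally have "real (Suc ?n) * 3 ^ ?n * sqrt (V (p t)) \<le> ?C * exp (- t / 2)"
        by (simp add: mult.assoc mult_left_mono)
      then have W: "(\<Sum>j\<le>?n. \<bar>?w (p t) j\<bar>) \<le> ?C * exp (- t / 2)"
        using chain_l1_le_cascade_l2[of "?w (p t)" ?n] unfolding V_def by linarith
      have "0 \<le> (\<Sum>j<?n. \<bar>?w (p t) (Suc j)\<bar>)"
        by (simp add: sum_nonneg)
      then show ?thesis
        using W output_error_le_chain[of "p t" c] unfolding chain_l1_eq chain_var_0 by linarith
    qed
    then show "\<exists>C\<ge>0. \<forall>T p. solution_on (closed_loop_field ystar f g h k) T p \<longrightarrow> p 0 = p0 \<longrightarrow>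
       (\<forall>t\<in>{0..T}. \<bar>c - fst (p t)\<bar> \<le> C * exp (- t / 2) \<and>
          norm (output_error (snd (p t))) \<le> C * exp (- t / 2))"
      using V_nonneg by (intro exI[of _ ?C]) auto
  qed
qed

lemma closed_loop_error_decay:
  assumes sol: "closed_loop_solution ystar f g h k \<xi> x"
  shows "\<exists>C\<ge>0. \<forall>t\<ge>0. norm (output_error (x t)) \<le> C * exp (- t / 2)"
proof -
  let ?p = "\<lambda>t. (integral {0..t} (reg_error ystar h x), x t)"
  have p: "?p 0 = (0, \<xi>)" "solution_on (closed_loop_field ystar f g h k) T ?p" for T
    using closed_loop_solution_imp_field[OF sol] by auto
  obtain C where "0 \<le> C" and C: "\<And>T p. solution_on (closed_loop_field ystar f g h k) T p \<Longrightarrow> p 0 = (0, \<xi>) \<Longrightarrow>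
     \<forall>t\<in>{0..T}. norm (output_error (snd (p t))) \<le> C * exp (- t / 2)"
    using closed_loop_decay by metis
  have "norm (output_error (x t)) \<le> C * exp (- t / 2)" if "0 \<le> t" for t
    using C[OF p(2)[of t] p(1)] that by simp
  then show ?thesis using \<open>0 \<le> C\<close> by blast
qed

lemma abs_reg_error_le: "\<bar>reg_error ystar h x t\<bar> \<le> norm (output_error (x t))"
proof -
  obtain i :: 'n where "pos i = 0"
    using ex_pos[of 0] by auto
  then have "\<bar>reg_error ystar h x t\<bar> = \<bar>output_error (x t) $ i\<bar>"
    by (simp add: reg_error_def Phi_def zstar_def)
  then show ?thesis
    using component_le_norm_cart[of "output_error (x t)" i] by simp
qed

lemma closed_loop_exp_convergent:
  assumes sol: "closed_loop_solution ystar f g h k \<xi> x"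
  shows "exp_convergent (reg_error ystar h x)"
proof -
  obtain C where C: "0 \<le> C" "\<And>t. 0 \<le> t \<Longrightarrow> norm (output_error (x t)) \<le> C * exp (- t / 2)"
    using closed_loop_error_decay[OF sol] by auto
  have "\<bar>reg_error ystar h x t\<bar> \<le> (C + 1) * exp (- (1 / 2) * t)" if "0 \<le> t" for t
  proof -
    have "\<bar>reg_error ystar h x t\<bar> \<le> C * exp (- t / 2)"
      using abs_reg_error_le C(2)[OF that] by (rule order_trans)
    also have "\<dots> \<le> (C + 1) * exp (- t / 2)"
      by (intro mult_right_mono) auto
    finally show ?thesis by simp
  qed
  then show ?thesis
    (* C + 1 because the constant has to be positive *)
    unfolding exp_convergent_def using C(1) by (intro exI[of _ "C + 1"] conjI exI[of _ "1 / 2"]) auto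
qed

text \<open>The decay estimate bounds the integral state and the output error on every solution, so
  existence only needs a bound on the plant state in terms of these two.\<close>

lemma closed_loop_exists:
  assumes state_bound: "\<And>r T. \<exists>R. \<forall>S\<in>{0..T}. \<forall>p. solution_on (closed_loop_field ystar f g h k) S p \<longrightarrow>
      snd (p 0) = \<xi> \<longrightarrow> (\<forall>t\<in>{0..S}. \<bar>fst (p t)\<bar> \<le> r \<and> norm (output_error (snd (p t))) \<le> r) \<longrightarrow>
      norm (snd (p S)) \<le> R"
  shows "\<exists>x. closed_loop_solution ystar f g h k \<xi> x"
proof -
  let ?W = "closed_loop_field ystar f g h k"
  obtain c C where "0 \<le> C" and C: "\<And>T p. solution_on ?W T p \<Longrightarrow> p 0 = (0, \<xi>) \<Longrightarrow>
     \<forall>t\<in>{0..T}. \<bar>c - fst (p t)\<bar> \<le> C * exp (- t / 2) \<and> norm (output_error (snd (p t))) \<le> C * exp (- t / 2)"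
    using closed_loop_decay by metis
  let ?r = "\<bar>c\<bar> + C"
  have r: "\<forall>t\<in>{0..T}. \<bar>fst (p t)\<bar> \<le> ?r \<and> norm (output_error (snd (p t))) \<le> ?r"
    if "solution_on ?W T p" "p 0 = (0, \<xi>)" for T p
  proof
    fix t assume t: "t \<in> {0..T}"
    then have "C * exp (- t / 2) \<le> C"
      using \<open>0 \<le> C\<close> by (simp add: mult_left_le)
    then show "\<bar>fst (p t)\<bar> \<le> ?r \<and> norm (output_error (snd (p t))) \<le> ?r"
      using C[OF that] t by fastforce
  qed
  have "\<exists>R. \<forall>S\<in>{0..T}. \<forall>p. p 0 = (0, \<xi>) \<longrightarrow> solution_on ?W S p \<longrightarrow> norm (p S) \<le> R" for T
  proof -
    obtain R where R: "\<And>S p. S \<in> {0..T} \<Longrightarrow> solution_on ?W S p \<Longrightarrow> snd (p 0) = \<xi> \<Longrightarrow>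
        (\<forall>t\<in>{0..S}. \<bar>fst (p t)\<bar> \<le> ?r \<and> norm (output_error (snd (p t))) \<le> ?r) \<Longrightarrow> norm (snd (p S)) \<le> R"
      using state_bound by metis
    have "norm (p S) \<le> ?r + R" if S: "S \<in> {0..T}" and p: "p 0 = (0, \<xi>)" "solution_on ?W S p" for S p
    proof -
      have "\<bar>fst (p S)\<bar> \<le> ?r"
        using r[OF p(2,1)] S by auto
      moreover have "norm (snd (p S)) \<le> R"
        using R[OF S p(2) _ r[OF p(2,1)]] p(1) by simp
      ultimately show ?thesis
        using norm_Pair_le[of "fst (p S)" "snd (p S)"] by simp
    qed
    then show ?thesis by blast
  qed
  then obtain p where "p 0 = (0, \<xi>)"
    "\<And>t. 0 \<le> t \<Longrightarrow> (p has_vector_derivative ?W (p t)) (at t within {0..})"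
    using global_solution_if_bounded[OF lipschitz_on_balls_closed_loop_field[OF smooth_f smooth_g smooth_h]]
    by metis
  then show ?thesis
    using field_imp_closed_loop_solution by blast
qed

text \<open>If \<open>\<Phi>\<close> is a diffeomorphism, bounded output errors confine the state to a compact
  set.\<close>

lemma closed_loop_exists_diffeomorphism:
  assumes "assumption_C' f h"
  shows "\<exists>x. closed_loop_solution ystar f g h k \<xi> x"
proof (rule closed_loop_exists)
  fix r T :: real
  have bij: "bij (Phi f h)" and "Ck 1 (inv (Phi f h))"
    using assms unfolding assumption_C'_def C1_diffeomorphism_def by blast+
  then have "compact (inv (Phi f h) ` cball (zstar ystar) r)"
    by (intro compact_continuous_image compact_cball continuous_on_subset[OF Ck_imp_continuous subset_UNIV])
  then obtain R where R: "\<And>z. z \<in> cball (zstar ystar) r \<Longrightarrow> norm (inv (Phi f h) z) \<le> R"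
    using compact_imp_bounded bounded_iff by (metis (no_types, lifting) imageI)
  have "norm y \<le> R" if "norm (output_error y) \<le> r" for y
    using R[of "Phi f h y"] that bij_is_inj[OF bij] by (simp add: dist_norm norm_minus_commute)
  then show "\<exists>R. \<forall>S\<in>{0..T}. \<forall>p. solution_on (closed_loop_field ystar f g h k) S p \<longrightarrow>
      snd (p 0) = \<xi> \<longrightarrow> (\<forall>t\<in>{0..S}. \<bar>fst (p t)\<bar> \<le> r \<and> norm (output_error (snd (p t))) \<le> r) \<longrightarrow>
      norm (snd (p S)) \<le> R"
    by (intro exI[of _ R]) auto
qed

lemma closed_loop_converges_diffeomorphism:
  assumes C': "assumption_C' f h" and sol: "closed_loop_solution ystar f g h k \<xi> x"
  shows "bounded (x ` {0..})" and "(x \<longlongrightarrow> inv (Phi f h) (zstar ystar)) at_top"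
proof -
  let ?\<Psi> = "inv (Phi f h)"
  have bij: "bij (Phi f h)" and "Ck 1 ?\<Psi>"
    using C' unfolding assumption_C'_def C1_diffeomorphism_def by blast+
  then have cont: "continuous_on UNIV ?\<Psi>"
    by (intro Ck_imp_continuous)
  have inv: "?\<Psi> (Phi f h y) = y" for y
    using bij_is_inj[OF bij] by simp
  obtain C where C: "0 \<le> C" "\<And>t. 0 \<le> t \<Longrightarrow> norm (output_error (x t)) \<le> C * exp (- t / 2)"
    using closed_loop_error_decay[OF sol] by auto
  have "norm (output_error (x t)) \<le> C" if "0 \<le> t" for t
  proof -
    have "C * exp (- t / 2) \<le> C"
      using C(1) that by (simp add: mult_left_le)
    then show ?thesis using C(2)[OF that] by linarith
  qed
  then have "x ` {0..} \<subseteq> ?\<Psi> ` cball (zstar ystar) C"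
    using inv by (force simp: dist_norm norm_minus_commute intro: image_eqI[of _ _ "Phi f h (x _)"])
  moreover have "bounded (?\<Psi> ` cball (zstar ystar) C)"
    by (intro compact_imp_bounded compact_continuous_image continuous_on_subset[OF cont]) auto
  ultimately show "bounded (x ` {0..})"
    by (rule bounded_subset[rotated])
  have "filterlim (\<lambda>t. 1 / 2 * t) at_top (at_top :: real filter)"
    by (intro filterlim_tendsto_pos_mult_at_top[OF tendsto_const _ filterlim_ident]) simp
  then have "filterlim (\<lambda>t. - t / 2) at_bot (at_top :: real filter)"
    by (simp add: filterlim_uminus_at_bot)
  then have "((\<lambda>t. C * exp (- t / 2)) \<longlongrightarrow> C * 0) at_top"
    by (intro tendsto_mult tendsto_const filterlim_compose[OF exp_at_bot])
  then have "((\<lambda>t. C * exp (- t / 2)) \<longlongrightarrow> 0) at_top"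
    by simp
  moreover have "\<forall>\<^sub>F t in at_top. norm (output_error (x t)) \<le> C * exp (- t / 2)"
    using eventually_ge_at_top[of 0] by (rule eventually_mono) (rule C(2))
  ultimately have "((\<lambda>t. output_error (x t)) \<longlongrightarrow> 0) at_top"
    by (rule Lim_null_comparison[rotated])
  then have "((\<lambda>t. Phi f h (x t)) \<longlongrightarrow> zstar ystar) at_top"
    by (simp add: LIM_zero_iff)
  then have "((\<lambda>t. ?\<Psi> (Phi f h (x t))) \<longlongrightarrow> ?\<Psi> (zstar ystar)) at_top"
    using cont by (intro isCont_tendsto_compose[of _ ?\<Psi>]) (auto simp: continuous_on_eq_continuous_at)
  then show "(x \<longlongrightarrow> ?\<Psi> (zstar ystar)) at_top"
    by (simp add: inv)
qed

text \<open>Along a solution, the Jacobian maps the state velocity to the velocity of the normal form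
  coordinates, which is bounded by the output error and the input. Inverting the Jacobian, the
  state velocity grows at most like \<open>\<parallel>x\<parallel> log \<parallel>x\<parallel>\<close>.\<close>

lemma jacobian_velocity_bound:
  assumes u: "\<bar>u\<bar> \<le> U" and e: "norm (output_error y) \<le> r"
  shows "norm (jacobian (Phi f h) (at y) *v (f y + u *\<^sub>R g y))
    \<le> real CARD('n) * (norm (zstar ystar :: 'n state) + r + \<tau> (norm (zstar ystar :: 'n state) + r) + U * b_up)"
proof -
  let ?\<rho> = "norm (zstar ystar :: 'n state) + r" and ?v = "jacobian (Phi f h) (at y) *v (f y + u *\<^sub>R g y)"
  let ?B = "?\<rho> + \<tau> ?\<rho> + U * b_up"
  have \<Phi>: "norm (Phi f h y) \<le> ?\<rho>"
    using e norm_triangle_sub[of "Phi f h y" "zstar ystar"] by linarith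
  then have \<rho>: "0 \<le> ?\<rho>"
    using norm_ge_zero order_trans by blast
  have comp: "?v $ i = out_lie (Suc (pos i)) y + u * lie g (out_lie (pos i)) y" for i
  proof -
    have "?v = dir_deriv (Phi f h) (f y + u *\<^sub>R g y) y"
      by (simp add: dir_deriv_eqI[OF jacobian_Phi[OF smooth_f smooth_h]])
    then show ?thesis
      by (simp only: dir_deriv_Phi[OF smooth_f smooth_h] out_lie_dir_deriv)
  qed
  have "\<bar>?v $ i\<bar> \<le> ?B" for i
  proof (cases "pos i + 1 < CARD('n)")
    case True
    then obtain i' :: 'n where "pos i' = Suc (pos i)"
      using ex_pos[of "Suc (pos i)"] by auto
    then have "?v $ i = Phi f h y $ i'"
      using comp[of i] lie_g_zero[OF True] by (simp add: Phi_def)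
    then have "\<bar>?v $ i\<bar> \<le> ?\<rho>"
      using component_le_norm_cart[of "Phi f h y" i'] \<Phi> by simp
    moreover have "0 \<le> U * b_up"
      using u b_up_pos by (intro mult_nonneg_nonneg) auto
    ultimately show ?thesis
      using \<tau>_nonneg[OF \<rho>] by linarith
  next
    case False
    then have i: "Suc (pos i) = CARD('n)" "pos i = CARD('n) - 1"
      using pos_less[of i] by auto
    have "?v $ i = F_fun f h y + u * G_fun f g h y"
      unfolding comp F_fun_def G_fun_def i(1) using i(2) by simp
    moreover have "\<bar>F_fun f h y\<bar> \<le> \<tau> ?\<rho>"
    proof -
      have "\<bar>F_fun f h y\<bar> \<le> \<tau> (norm (Phi f h y))"
        using H_le[of y] norm_fst_snd_le(1)[of "H_fun f g h y"] by (simp add: H_fun_def)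
      also have "\<dots> \<le> \<tau> ?\<rho>"
        using \<Phi> \<rho> by (intro mono_onD[OF mono_\<tau>]) auto
      finally show ?thesis .
    qed
    moreover have "\<bar>u * G_fun f g h y\<bar> \<le> U * b_up"
      unfolding abs_mult using u G_ge[of y] G_le[of y] b_lo_pos by (intro mult_mono) auto
    ultimately show ?thesis
      using \<rho> abs_triangle_ineq[of "F_fun f h y" "u * G_fun f g h y"] by linarith
  qed
  then have "(\<Sum>i\<in>UNIV. \<bar>?v $ i\<bar>) \<le> of_nat (card (UNIV :: 'n set)) * ?B"
    by (intro sum_bounded_above) auto
  then show ?thesis
    using norm_le_l1_cart[of ?v] by linarith
qed

lemma closed_loop_exists_log_growth:
  assumes C: "assumption_C f h"
  shows "\<exists>x. closed_loop_solution ystar f g h k \<xi> x"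
proof (rule closed_loop_exists)
  fix r T :: real
  obtain N1 N2 where N: "0 < N1" "0 < N2" and
    J: "\<And>y. onorm ((*v) (matrix_inv (jacobian (Phi f h) (at y)))) \<le> N1 * norm y * ln (norm y) + N2"
    using C unfolding assumption_C_def by blast
  let ?U = "\<bar>fst k\<bar> * r + norm (snd k) * r"
  let ?B = "real CARD('n) * (norm (zstar ystar :: 'n state) + r + \<tau> (norm (zstar ystar :: 'n state) + r) + ?U * b_up)"
  let ?a = "?B * N1" and ?b = "?B * N2"
  let ?R = "exp (ln (exp 1 + (norm \<xi>)\<^sup>2) * exp ((?a + ?b) * T))"
  have velocity: "0 \<le> ?B \<and> norm (f (snd p) + feedback ystar f h k p *\<^sub>R g (snd p))
      \<le> ?a * norm (snd p) * ln (norm (snd p)) + ?b"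
    if p: "\<bar>fst p\<bar> \<le> r" "norm (output_error (snd p)) \<le> r" for p
  proof -
    let ?y = "snd p" and ?u = "feedback ystar f h k p"
    let ?J = "jacobian (Phi f h) (at ?y)" and ?v = "f ?y + ?u *\<^sub>R g ?y"
    have "\<bar>?u\<bar> \<le> \<bar>fst k * fst p\<bar> + \<bar>snd k \<bullet> output_error ?y\<bar>"
      unfolding feedback_def by (rule abs_triangle_ineq4)
    also have "\<dots> \<le> ?U"
      unfolding abs_mult
      using p Cauchy_Schwarz_ineq2[of "snd k" "output_error ?y"]
      by (intro add_mono mult_left_mono) (auto intro: order_trans[OF _ mult_left_mono])
    finally have Jv: "norm (?J *v ?v) \<le> ?B"
      using p(2) by (rule jacobian_velocity_bound)
    then have B: "0 \<le> ?B"
      by (rule order_trans[OF norm_ge_zero])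
    have "?v = matrix_inv ?J *v (?J *v ?v)"
      using matrix_inv_mult_left[OF invertible_jacobian_Phi[OF smooth_f smooth_g smooth_h rel_degree]]
      by (simp add: matrix_vector_mul_assoc)
    then have "norm ?v \<le> onorm ((*v) (matrix_inv ?J)) * norm (?J *v ?v)"
      using onorm[OF matrix_vector_mul_bounded_linear[of "matrix_inv ?J"], of "?J *v ?v"] by simp
    also have "\<dots> \<le> onorm ((*v) (matrix_inv ?J)) * ?B"
      by (rule mult_left_mono[OF Jv onorm_pos_le[OF matrix_vector_mul_bounded_linear]])
    also have "\<dots> \<le> (N1 * norm ?y * ln (norm ?y) + N2) * ?B"
      by (rule mult_right_mono[OF J B])
    finally show ?thesis
      using B by (simp add: algebra_simps)
  qed
  have "norm (snd (p S)) \<le> ?R"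
    if S: "S \<in> {0..T}" and sol: "solution_on (closed_loop_field ystar f g h k) S p" and init: "snd (p 0) = \<xi>"
      and r: "\<And>t. t \<in> {0..S} \<Longrightarrow> \<bar>fst (p t)\<bar> \<le> r \<and> norm (output_error (snd (p t))) \<le> r" for S p
  proof -
    have x: "((\<lambda>t. snd (p t)) has_vector_derivative
        f (snd (p t)) + feedback ystar f h k (p t) *\<^sub>R g (snd (p t))) (at t within {0..S})"
      if "t \<in> {0..S}" for t
      using sol that bounded_linear.has_vector_derivative[OF bounded_linear_snd, of p _ "at t within {0..S}"]
      unfolding solution_on_def closed_loop_field_def by fastforce
    have B: "0 \<le> ?B"
    proof -
      have "0 \<in> {0..S}" using S by simp
      then show ?thesis using velocity r by blast
    qed
    have ab: "0 \<le> ?a" "0 \<le> ?b"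
      by (rule mult_nonneg_nonneg[OF B less_imp_le[OF N(1)]], rule mult_nonneg_nonneg[OF B less_imp_le[OF N(2)]])
    have "norm (snd (p S)) \<le> exp (ln (exp 1 + (norm (snd (p 0)))\<^sup>2) * exp ((?a + ?b) * S))"
    proof (rule norm_bound_if_log_growth[OF x])
      show "norm (f (snd (p t)) + feedback ystar f h k (p t) *\<^sub>R g (snd (p t)))
          \<le> ?a * norm (snd (p t)) * ln (norm (snd (p t))) + ?b" if "t \<in> {0..S}" for t
        using velocity r[OF that] by blast
      show "0 \<le> ?a" "0 \<le> ?b"
        by (rule ab)+
      show "S \<in> {0..S}" using S by simp
    qed
    also have "\<dots> \<le> ?R"
    proof -
      have "1 \<le> exp 1 + (norm \<xi>)\<^sup>2"
        by (simp add: add_increasing2)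
      moreover have "(?a + ?b) * S \<le> (?a + ?b) * T"
        using S by (intro mult_left_mono add_nonneg_nonneg ab) simp
      ultimately show ?thesis
        unfolding init by (simp add: mult_left_mono)
    qed
    finally show ?thesis .
  qed
  then show "\<exists>R. \<forall>S\<in>{0..T}. \<forall>p. solution_on (closed_loop_field ystar f g h k) S p \<longrightarrow>
      snd (p 0) = \<xi> \<longrightarrow> (\<forall>t\<in>{0..S}. \<bar>fst (p t)\<bar> \<le> r \<and> norm (output_error (snd (p t))) \<le> r) \<longrightarrow>
      norm (snd (p S)) \<le> R"
    by (intro exI[of _ ?R]) blast
qed

end

theorem theorem2:
  shows "(\<forall>ystar b_lo b_up L \<tau>.
            0 < b_lo \<and> 0 < b_up \<and> 0 < L \<and> mono_on {0..} \<tau> \<and> (\<forall>s\<ge>0. 0 \<le> \<tau> s) \<longrightarrow>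
            (\<exists>\<Omega> :: 'n::{finite,linorder} gains set. open \<Omega> \<and> \<not> bounded \<Omega> \<and>
               (\<forall>f g h. smooth f \<and> smooth g \<and> smooth h \<and>
                  assumption_A b_lo f g h \<and> assumption_B1 ystar b_up L \<tau> f g h \<and> assumption_C f h \<longrightarrow>
                  (\<forall>k\<in>\<Omega>. \<forall>\<xi>.
                     (\<exists>x. closed_loop_solution ystar f g h k \<xi> x) \<and>
                     (\<forall>x. closed_loop_solution ystar f g h k \<xi> x \<longrightarrow>
                        exp_convergent (reg_error ystar h x))))))
       \<and> (\<exists>xstar :: real \<Rightarrow> ('n state \<Rightarrow> 'n state) \<Rightarrow> 'n state.
          \<forall>ystar b_lo b_up L \<tau>.
            0 < b_lo \<and> 0 < b_up \<and> 0 < L \<and> mono_on {0..} \<tau> \<and> (\<forall>s\<ge>0. 0 \<le> \<tau> s) \<longrightarrow>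
            (\<exists>\<Omega> :: 'n gains set. open \<Omega> \<and> \<not> bounded \<Omega> \<and>
               (\<forall>f g h. smooth f \<and> smooth g \<and> smooth h \<and>
                  assumption_A b_lo f g h \<and> assumption_B1 ystar b_up L \<tau> f g h \<and> assumption_C' f h \<longrightarrow>
                  (\<forall>k\<in>\<Omega>. \<forall>\<xi>.
                     (\<exists>x. closed_loop_solution ystar f g h k \<xi> x) \<and>
                     (\<forall>x. closed_loop_solution ystar f g h k \<xi> x \<longrightarrow>
                        exp_convergent (reg_error ystar h x) \<and>
                        bounded (x ` {0..}) \<and>
                        (x \<longlongrightarrow> xstar ystar (Phi f h)) at_top)))))"
    (is "(\<forall>ystar b_lo b_up L \<tau>. ?data b_lo b_up L \<tau> \<longrightarrow> ?log_growth ystar b_lo b_up L \<tau>) \<and>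
      (\<exists>xstar. \<forall>ystar b_lo b_up L \<tau>. ?data b_lo b_up L \<tau> \<longrightarrow> ?diffeo xstar ystar b_lo b_up L \<tau>)")
proof -
  have sys: "regulated_system f g h ystar b_lo b_up L \<tau> k"
    if "?data b_lo b_up L \<tau>" "smooth f" "smooth g" "smooth h" "assumption_A b_lo f g h"
      "assumption_B1 ystar b_up L \<tau> f g h" "k \<in> gain_set ystar b_lo b_up L \<tau>"
    for f g :: "'n vfield" and h ystar b_lo b_up L \<tau> k
    using that by unfold_locales (auto simp: assumption_A_def)
  have part1: "?log_growth ystar b_lo b_up L \<tau>" if data: "?data b_lo b_up L \<tau>" for ystar b_lo b_up L \<tau>
    using regulated_system.closed_loop_exists_log_growth[OF sys[OF data]]
      regulated_system.closed_loop_exp_convergent[OF sys[OF data]]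
    by (intro exI[of _ "gain_set ystar b_lo b_up L \<tau>"] conjI open_gain_set unbounded_gain_set) blast
  have part2: "?diffeo (\<lambda>y \<Phi>. inv \<Phi> (zstar y)) ystar b_lo b_up L \<tau>" if data: "?data b_lo b_up L \<tau>"
    for ystar b_lo b_up L \<tau>
  proof (intro exI[of _ "gain_set ystar b_lo b_up L \<tau>"] conjI open_gain_set unbounded_gain_set
      allI ballI impI)
    fix f g :: "'n vfield" and h and k :: "'n gains" and \<xi>
    assume fgh: "smooth f \<and> smooth g \<and> smooth h \<and> assumption_A b_lo f g h
        \<and> assumption_B1 ystar b_up L \<tau> f g h \<and> assumption_C' f h"
      and k: "k \<in> gain_set ystar b_lo b_up L \<tau>"
    interpret regulated_system f g h ystar b_lo b_up L \<tau> k
      by (rule sys[OF data _ _ _ _ _ k]) (use fgh in blast)+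
    have C': "assumption_C' f h" using fgh by blast
    show "\<exists>x. closed_loop_solution ystar f g h k \<xi> x"
      by (rule closed_loop_exists_diffeomorphism[OF C'])
    fix x assume sol: "closed_loop_solution ystar f g h k \<xi> x"
    show "exp_convergent (reg_error ystar h x)"
      by (rule closed_loop_exp_convergent[OF sol])
    show "bounded (x ` {0..})" "(x \<longlongrightarrow> inv (Phi f h) (zstar ystar)) at_top"
      by (rule closed_loop_converges_diffeomorphism[OF C' sol])+
  qed
  show ?thesis
  proof (intro conjI exI[of _ "\<lambda>y \<Phi>. inv \<Phi> (zstar y)"] allI impI)
    fix ystar b_lo b_up L \<tau> assume data: "?data b_lo b_up L \<tau>"
    show "?log_growth ystar b_lo b_up L \<tau>"
      by (rule part1[OF data])
    show "?diffeo (\<lambda>y \<Phi>. inv \<Phi> (zstar y)) ystar b_lo b_up L \<tau>"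
      by (rule part2[OF data])
  qed
qed

end
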